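(* Let $p>1$ and let $u$ be a solution of (P) (with $u_0\in C(\overline\Omega)$, $u_0\ge0$) that blows up at time $T<\infty$. Then there exists a constant $C$ such that for all $t\in[0,T)$ $$(p-1)^{-1/(p-1)}(T-t)^{-1/(p-1)}\le\|u(\cdot,t)\|_{L^\infty(\Omega)}\le C(T-t)^{-1/(p-1)}.$$
   Context: Standing assumptions: $\Omega\subset\mathbb{R}^N$ bounded, connected, smooth; $J\in C(\mathbb{R}^N)$, $J\ge0$ symmetric, $\int J=1$, $J>0$ on $B(0,d)$, $J=0$ outside $B(0,d)$. There is $s_0>d$ such that $y=z+s\eta(z)$, $z\in\partial\Omega$, $s\in(0,s_0)$ ($\eta$ exterior unit normal) give coordinates on a neighborhood of $\partial\Omega$ in $\mathbb{R}^N\setminus\Omega$; $\overline u(z+s\eta(z),t)=u(z,t)$. Problem (P): $u_t(x,t)=\int_\Omega J(x-y)(u(y,t)-u(x,t))dy+\int_{\mathbb{R}^N\setminus\Omega}J(x-y)\overline u^p(y,t)dy$ for $x\in\overline\Omega$, $u(x,0)=u_0(x)$. "Blows up at time $T$" means $u$ is a solution on $[0,T)$ and $\|u(\cdot,t)\|_{L^\infty(\Omega)}\to\infty$ as $t\nearrow T$. *)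

theory Defs
  imports "HOL-Analysis.Analysis"
begin

fun C_k :: "nat \<Rightarrow> ('a::euclidean_space \<Rightarrow> real) \<Rightarrow> bool" where
  "C_k 0 f = continuous_on UNIV f"
| "C_k (Suc k) f = ((\<forall>x. f differentiable (at x)) \<and>
      (\<forall>i\<in>Basis. C_k k (\<lambda>x. frechet_derivative f (at x) i)))"

definition C_infinity :: "('a::euclidean_space \<Rightarrow> real) \<Rightarrow> bool" where
  "C_infinity f \<longleftrightarrow> (\<forall>k. C_k k f)"

definition grad :: "('a::euclidean_space \<Rightarrow> real) \<Rightarrow> 'a \<Rightarrow> 'a" where
  "grad f x = (\<Sum>i\<in>Basis. frechet_derivative f (at x) i *\<^sub>R i)"

definition smooth_domain_normal :: "'a::euclidean_space set \<Rightarrow> ('a \<Rightarrow> 'a) \<Rightarrow> bool" where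
  "smooth_domain_normal \<Omega> \<eta> \<longleftrightarrow>
     bounded \<Omega> \<and> connected \<Omega> \<and> \<Omega> \<noteq> {} \<and>
     (\<exists>\<phi>. C_infinity \<phi> \<and> \<Omega> = {x. \<phi> x < 0} \<and>
          (\<forall>z. \<phi> z = 0 \<longrightarrow> grad \<phi> z \<noteq> 0) \<and>
          (\<forall>z\<in>frontier \<Omega>. \<eta> z = (1 / norm (grad \<phi> z)) *\<^sub>R grad \<phi> z))"

definition kernel_J :: "('a::euclidean_space \<Rightarrow> real) \<Rightarrow> real \<Rightarrow> bool" where
  "kernel_J J d \<longleftrightarrow> d > 0 \<and> continuous_on UNIV J \<and> (\<forall>x. J x \<ge> 0) \<and>
     (\<forall>x. J (- x) = J x) \<and> integrable lborel J \<and> (LINT x|lborel. J x) = 1 \<and>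
     (\<forall>x. norm x < d \<longrightarrow> J x > 0) \<and> (\<forall>x. norm x \<ge> d \<longrightarrow> J x = 0)"

definition tubular_coords :: "'a::euclidean_space set \<Rightarrow> ('a \<Rightarrow> 'a) \<Rightarrow> real \<Rightarrow> bool" where
  "tubular_coords \<Omega> \<eta> s0 \<longleftrightarrow>
     inj_on (\<lambda>(z, s). z + s *\<^sub>R \<eta> z) (frontier \<Omega> \<times> {0<..<s0}) \<and>
     (\<lambda>(z, s). z + s *\<^sub>R \<eta> z) ` (frontier \<Omega> \<times> {0<..<s0}) =
        {y. y \<notin> closure \<Omega> \<and> infdist y \<Omega> < s0}"

text \<open>Extension ubar(z + s eta(z), t) = u(z, t) (and 0 where the coordinates are not
  defined; there J(x - y) = 0 for x in closure Omega since s0 > d).\<close>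
definition ubar :: "'a::euclidean_space set \<Rightarrow> ('a \<Rightarrow> 'a) \<Rightarrow> real \<Rightarrow> ('a \<Rightarrow> real \<Rightarrow> real)
    \<Rightarrow> 'a \<Rightarrow> real \<Rightarrow> real" where
  "ubar \<Omega> \<eta> s0 u y t =
     (if \<exists>z s. z \<in> frontier \<Omega> \<and> s \<in> {0<..<s0} \<and> y = z + s *\<^sub>R \<eta> z
      then u (SOME z. \<exists>s. z \<in> frontier \<Omega> \<and> s \<in> {0<..<s0} \<and> y = z + s *\<^sub>R \<eta> z) t
      else 0)"

text \<open>u is a (classical) solution of (P) on [0,T): continuous on closure Omega x [0,T),
  u(x,0) = u0(x), and for every x in closure Omega the time derivative (one-sided at 0)
  equals the right-hand side of (P). The nonlinearity ubar^p is taken as (max 0 ubar) powr p,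
  which agrees with ubar^p for the nonnegative solutions arising from u0 \<ge> 0.\<close>
definition solution_P :: "'a::euclidean_space set \<Rightarrow> ('a \<Rightarrow> real) \<Rightarrow> ('a \<Rightarrow> 'a) \<Rightarrow> real
    \<Rightarrow> real \<Rightarrow> ('a \<Rightarrow> real) \<Rightarrow> real \<Rightarrow> ('a \<Rightarrow> real \<Rightarrow> real) \<Rightarrow> bool" where
  "solution_P \<Omega> J \<eta> s0 p u0 T u \<longleftrightarrow>
     T > 0 \<and>
     continuous_on (closure \<Omega> \<times> {0..<T}) (\<lambda>(x, t). u x t) \<and>
     (\<forall>x\<in>closure \<Omega>. u x 0 = u0 x) \<and>
     (\<forall>x\<in>closure \<Omega>. \<forall>t\<in>{0..<T}.
        ((\<lambda>\<tau>. u x \<tau>) has_real_derivative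
           ((LINT y:\<Omega>|lborel. J (x - y) * (u y t - u x t)) +
            (LINT y:(- \<Omega>)|lborel. J (x - y) * (max 0 (ubar \<Omega> \<eta> s0 u y t)) powr p)))
        (at t within {0..<T}))"

definition Linf_norm :: "'a set \<Rightarrow> ('a \<Rightarrow> real \<Rightarrow> real) \<Rightarrow> real \<Rightarrow> real" where
  "Linf_norm \<Omega> u t = (SUP x\<in>\<Omega>. \<bar>u x t\<bar>)"

definition blows_up_at :: "'a::euclidean_space set \<Rightarrow> ('a \<Rightarrow> real) \<Rightarrow> ('a \<Rightarrow> 'a) \<Rightarrow> real
    \<Rightarrow> real \<Rightarrow> ('a \<Rightarrow> real) \<Rightarrow> real \<Rightarrow> ('a \<Rightarrow> real \<Rightarrow> real) \<Rightarrow> bool" where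
  "blows_up_at \<Omega> J \<eta> s0 p u0 T u \<longleftrightarrow>
     solution_P \<Omega> J \<eta> s0 p u0 T u \<and>
     filterlim (\<lambda>t. Linf_norm \<Omega> u t) at_top (at_left T)"

end

theory Submission
  imports Defs
begin

text \<open>
  Lower bound: at a spatial maximum of \<open>u\<close> the diffusion term is nonpositive and, since \<open>J\<close> has mass
  \<open>1\<close>, the source term is at most \<open>M\<^sup>p\<close>, where \<open>M\<close> is the maximum. So \<open>M\<close> grows no faster than a
  solution of \<open>v' = v\<^sup>p\<close>, which has to blow up at time \<open>T\<close> or earlier.

  Upper bound: the mass \<open>m\<close> of \<open>ubar\<close> in the thin layer \<open>N = {0 < dist y \<Omega> < d/4}\<close> satisfies
  \<open>m' \<ge> - m + c P\<close> with \<open>P\<close> the integral of \<open>ubar\<^sup>p\<close> over \<open>N\<close>, and \<open>P\<close> dominates a multiple of \<open>m\<^sup>p\<close>, so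
  \<open>w = e\<^sup>t m\<close> satisfies \<open>w' \<ge> k w\<^sup>p\<close> and therefore obeys the claimed rate. Conversely the source at any point
  is controlled by the integral of \<open>ubar\<^sup>p\<close> over the thick layer \<open>{0 < dist y \<Omega> < d}\<close>. Stretching along
  the normals is a Lipschitz map of the thin layer onto the thick one which preserves \<open>ubar\<close>, so this
  integral is at most a multiple of \<open>P\<close>, hence of \<open>w'\<close>, and by comparison \<open>u\<close> is at most a constant plus
  a multiple of \<open>w\<close>. The Lipschitz property needs no differentiability of the normal coordinates: it
  follows from the exterior ball condition of radius \<open>s0\<close>.
\<close>

section \<open>Lebesgue measure and integration\<close>

text \<open>Cut \<open>U\<close> into dyadic cubes with disjoint interiors. A cube of side
  \<open>s\<close> has diameter at most \<open>DIM('a) * s\<close>, so its image fits into a ball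
  whose volume is a fixed multiple of the volume of the cube.\<close>

lemma emeasure_lipschitz_image_le:
  fixes f :: "'a::euclidean_space \<Rightarrow> 'a"
  assumes U: "open U" "bounded U" and L: "L \<ge> 0"
    and lip: "\<And>x y. x \<in> U \<Longrightarrow> y \<in> U \<Longrightarrow> dist (f x) (f y) \<le> L * dist x y"
  shows "emeasure lborel (f ` U) \<le>
    ennreal (unit_ball_vol (DIM('a)) * (L * DIM('a)) ^ DIM('a)) * emeasure lborel U"
proof -
  define C where "C = unit_ball_vol (DIM('a)) * (L * DIM('a)) ^ DIM('a)"
  have C0: "C \<ge> 0" using L by (simp add: C_def)
  obtain r where r: "r > 0" "\<And>x. x \<in> U \<Longrightarrow> norm x \<le> r"
    using U(2) by (auto simp: bounded_pos)
  define a :: 'a where "a = - r *\<^sub>R One"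
  define b :: 'a where "b = r *\<^sub>R One"
  have Uab: "U \<subseteq> cbox a b"
  proof
    fix x assume "x \<in> U"
    then have "\<bar>x \<bullet> i\<bar> \<le> r" if "i \<in> Basis" for i
      using r(2)[of x] Basis_le_norm[OF that, of x] by linarith
    then show "x \<in> cbox a b"
      by (force simp: mem_box a_def b_def)
  qed
  have ab: "box a b \<noteq> {}"
    using r(1) by (auto simp: box_ne_empty a_def b_def)
  \<comment> \<open>For this gauge a cube tagged in \<open>U\<close> must lie inside
    \<open>U\<close>, so the total volume of the cubes does not exceed that of
    \<open>U\<close>.\<close>
  have "gauge (\<lambda>x. if x \<in> U then U else UNIV)"
    using U(1) by (auto simp: gauge_def)
  from covering_lemma[OF Uab ab this] obtain D where D: "countable D"
      "\<And>K. K \<in> D \<Longrightarrow> interior K \<noteq> {} \<and> (\<exists>c d. K = cbox c d)"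
      "pairwise (\<lambda>A B. interior A \<inter> interior B = {}) D"
      "\<And>K. K \<in> D \<Longrightarrow> \<exists>x \<in> U \<inter> K. K \<subseteq> (if x \<in> U then U else UNIV)"
      "\<And>u v. cbox u v \<in> D \<Longrightarrow> \<exists>n. \<forall>i \<in> Basis. v \<bullet> i - u \<bullet> i = (b \<bullet> i - a \<bullet> i) / 2^n"
      "U \<subseteq> \<Union>D" by metis
  have DU: "K \<subseteq> U" if "K \<in> D" for K using D(4)[OF that] by auto
  have cube: "\<exists>z e. f ` K \<subseteq> cball z e \<and>
      emeasure lborel (cball z e) \<le> ennreal C * emeasure lborel (interior K)" if K: "K \<in> D" for K
  proof -
    obtain u v where uv: "K = cbox u v" "box u v \<noteq> {}"
      using D(2)[OF K] by (metis interior_cbox)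
    obtain n where n: "\<forall>i \<in> Basis. v \<bullet> i - u \<bullet> i = (b \<bullet> i - a \<bullet> i) / 2^n"
      using D(5) K uv by blast
    \<comment> \<open>\<open>cbox a b\<close> is a cube of edge \<open>2 * r\<close>, so after
      \<open>n\<close> halvings all edges are equal to \<open>s\<close>.\<close>
    define s where "s = 2 * r / 2 ^ n"
    have s: "\<And>i. i \<in> Basis \<Longrightarrow> v \<bullet> i - u \<bullet> i = s" "s > 0"
      using n r(1) by (auto simp: a_def b_def s_def)
    have "f ` K \<subseteq> cball (f u) (L * (DIM('a) * s))"
    proof clarify
      fix x assume x: "x \<in> K"
      have uK: "u \<in> K" using uv by (auto simp: box_ne_empty mem_box less_imp_le)
      have "dist u x \<le> (\<Sum>i\<in>Basis. \<bar>(u - x) \<bullet> i\<bar>)" by (simp add: dist_norm norm_le_l1)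
      also have "\<dots> \<le> (\<Sum>i\<in>(Basis::'a set). s)"
      proof (rule sum_mono)
        fix i :: 'a assume i: "i \<in> Basis"
        then have "u \<bullet> i \<le> x \<bullet> i" "x \<bullet> i \<le> v \<bullet> i" using x uv by (auto simp: mem_box)
        then show "\<bar>(u - x) \<bullet> i\<bar> \<le> s" using s(1)[OF i] by (simp add: inner_diff_left)
      qed
      finally have "dist u x \<le> DIM('a) * s" by simp
      then have "L * dist u x \<le> L * (DIM('a) * s)" using L by (rule mult_left_mono)
      then show "f x \<in> cball (f u) (L * (DIM('a) * s))"
        using lip[of u x] uK x DU[OF K] by (meson mem_cball order_trans subsetD)
    qed
    moreover have "emeasure lborel (interior K) = ennreal (s ^ DIM('a))"
      using uv s by (simp add: emeasure_lborel_box_eq box_ne_empty less_imp_le inner_diff_left)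
    moreover have "emeasure lborel (cball (f u) (L * (DIM('a) * s))) = ennreal (C * s ^ DIM('a))"
      using L s by (subst emeasure_cball) (auto simp: C_def power_mult_distrib)
    ultimately show ?thesis
      using C0 s by (intro exI[of _ "f u"] exI[of _ "L * (DIM('a) * s)"]) (simp add: ennreal_mult)
  qed
  \<comment> \<open>Enumeration over all naturals, padded with \<open>{}\<close>, so that finite and
    infinite \<open>D\<close> are treated alike.\<close>
  define K where "K n = (if n \<in> to_nat_on D ` D then from_nat_into D n else {})" for n
  have Kin: "K n \<in> D \<or> K n = {}" for n
    by (auto simp: K_def D(1))
  have "\<exists>B. B \<in> sets borel \<and> f ` (K n) \<subseteq> B \<and>
      emeasure lborel B \<le> ennreal C * emeasure lborel (interior (K n))" for n
  proof (cases "K n = {}")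
    case True
    then show ?thesis by (intro exI[of _ "{}"]) auto
  next
    case False
    then have "K n \<in> D" using Kin by auto
    from cube[OF this] show ?thesis by (metis borel_closed closed_cball)
  qed
  then obtain B where B: "\<And>n. B n \<in> sets borel" "\<And>n. f ` (K n) \<subseteq> B n"
      "\<And>n. emeasure lborel (B n) \<le> ennreal C * emeasure lborel (interior (K n))" by metis
  have "U \<subseteq> (\<Union>n. K n)"
  proof
    fix x assume "x \<in> U"
    then obtain S where "S \<in> D" "x \<in> S" using D(6) by auto
    then have "x \<in> K (to_nat_on D S)" using D(1) by (simp add: K_def)
    then show "x \<in> (\<Union>n. K n)" by blast
  qed
  then have "f ` U \<subseteq> (\<Union>n. B n)" using B(2) by blast
  then have "emeasure lborel (f ` U) \<le> emeasure lborel (\<Union>n. B n)"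
    using B(1) by (intro emeasure_mono) auto
  also have "\<dots> \<le> (\<Sum>n. emeasure lborel (B n))"
    using B(1) by (intro emeasure_subadditive_countably) auto
  also have "\<dots> \<le> (\<Sum>n. ennreal C * emeasure lborel (interior (K n)))"
    by (intro suminf_le B(3)) auto
  also have "\<dots> = ennreal C * (\<Sum>n. emeasure lborel (interior (K n)))"
    by (rule ennreal_suminf_cmult)
  \<comment> \<open>The interiors are disjoint, so the series is exactly the measure of a subset of
    \<open>U\<close>.\<close>
  also have "(\<Sum>n. emeasure lborel (interior (K n))) = emeasure lborel (\<Union>n. interior (K n))"
  proof (rule suminf_emeasure)
    show "disjoint_family (\<lambda>n. interior (K n))"
      unfolding disjoint_family_on_def
    proof (intro ballI impI)
      fix m n :: nat assume mn: "m \<noteq> n"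
      show "interior (K m) \<inter> interior (K n) = {}"
      proof (cases "m \<in> to_nat_on D ` D \<and> n \<in> to_nat_on D ` D")
        case True
        then obtain P Q where "P \<in> D" "Q \<in> D" "m = to_nat_on D P" "n = to_nat_on D Q" by auto
        then have "K m = P" "K n = Q" "P \<noteq> Q" "P \<in> D" "Q \<in> D" using D(1) mn by (auto simp: K_def)
        then show ?thesis using D(3) by (auto simp: pairwise_def)
      qed (auto simp: K_def)
    qed
  qed auto
  also have "\<dots> \<le> emeasure lborel U"
  proof (rule emeasure_mono)
    show "(\<Union>n. interior (K n)) \<subseteq> U"
      using Kin DU interior_subset by (metis (no_types, lifting) UN_least empty_subsetI interior_empty order_trans)
  qed (use U in auto)
  finally show ?thesis by (simp add: C_def mult_left_mono)
qed

text \<open>Layer-cake formula: write the value as the length of \<open>{0..<h x}\<close> and swap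
  the integrals by Tonelli. Negative values of \<open>h\<close> give the empty interval, in
  agreement with \<open>ennreal\<close>.\<close>

lemma nn_integral_superlevel:
  fixes h :: "'a \<Rightarrow> real"
  assumes "sigma_finite_measure M" "h \<in> borel_measurable M"
  shows "(\<integral>\<^sup>+x. ennreal (h x) \<partial>M) =
    (\<integral>\<^sup>+\<tau>. emeasure M {x \<in> space M. \<tau> < h x} * indicator {0..} \<tau> \<partial>lborel)"
proof -
  interpret M: sigma_finite_measure M by fact
  interpret pair_sigma_finite M lborel ..
  have "(\<integral>\<^sup>+x. ennreal (h x) \<partial>M) = (\<integral>\<^sup>+x. (\<integral>\<^sup>+\<tau>. indicator {0..<h x} \<tau> \<partial>lborel) \<partial>M)"
  proof (intro nn_integral_cong)
    fix x
    show "ennreal (h x) = (\<integral>\<^sup>+\<tau>. indicator {0..<h x} \<tau> \<partial>lborel)"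
      by (cases "h x \<ge> 0") (auto simp: ennreal_neg)
  qed
  also have "\<dots> = (\<integral>\<^sup>+x. (\<integral>\<^sup>+\<tau>. indicator {z \<in> space (M \<Otimes>\<^sub>M lborel). 0 \<le> snd z \<and> snd z < h (fst z)} (x, \<tau>) \<partial>lborel) \<partial>M)"
    by (intro nn_integral_cong) (auto simp: indicator_def space_pair_measure)
  also have "\<dots> = (\<integral>\<^sup>+\<tau>. (\<integral>\<^sup>+x. indicator {z \<in> space (M \<Otimes>\<^sub>M lborel). 0 \<le> snd z \<and> snd z < h (fst z)} (x, \<tau>) \<partial>M) \<partial>lborel)"
  proof (rule Fubini[symmetric, of "indicator {z \<in> space (M \<Otimes>\<^sub>M lborel). 0 \<le> snd z \<and> snd z < h (fst z)}"])
    have [measurable]: "h \<in> borel_measurable M" by fact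
    have "{z \<in> space (M \<Otimes>\<^sub>M lborel). 0 \<le> snd z \<and> snd z < h (fst z)} \<in> sets (M \<Otimes>\<^sub>M lborel)"
      by measurable
    then show "indicator {z \<in> space (M \<Otimes>\<^sub>M lborel). 0 \<le> snd z \<and> snd z < h (fst z)}
        \<in> borel_measurable (M \<Otimes>\<^sub>M lborel)" by (rule borel_measurable_indicator)
  qed
  also have "\<dots> = (\<integral>\<^sup>+\<tau>. emeasure M {x \<in> space M. \<tau> < h x} * indicator {0..} \<tau> \<partial>lborel)"
  proof (intro nn_integral_cong)
    fix \<tau> :: real
    have "(\<integral>\<^sup>+x. indicator {z \<in> space (M \<Otimes>\<^sub>M lborel). 0 \<le> snd z \<and> snd z < h (fst z)} (x, \<tau>) \<partial>M) =
      (\<integral>\<^sup>+x. indicator {0..} \<tau> * indicator {x \<in> space M. \<tau> < h x} x \<partial>M)"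
      by (intro nn_integral_cong) (auto simp: indicator_def space_pair_measure)
    also have "\<dots> = indicator {0..} \<tau> * emeasure M {x \<in> space M. \<tau> < h x}"
      using assms(2) by (subst nn_integral_cmult) (auto simp: mult.commute)
    finally show "(\<integral>\<^sup>+x. indicator {z \<in> space (M \<Otimes>\<^sub>M lborel). 0 \<le> snd z \<and> snd z < h (fst z)} (x, \<tau>) \<partial>M) =
        emeasure M {x \<in> space M. \<tau> < h x} * indicator {0..} \<tau>"
      by (simp add: mult.commute)
  qed
  finally show ?thesis .
qed

text \<open>The superlevel sets are the sections of one product-measurable set. This is what allows
  a constant to be pulled out of a layer-cake integral.\<close>

lemma borel_measurable_emeasure_superlevel:
  fixes h :: "'a \<Rightarrow> real"
  assumes "sigma_finite_measure M" and [measurable]: "h \<in> borel_measurable M"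
  shows "(\<lambda>\<tau>. emeasure M {x \<in> space M. \<tau> < h x}) \<in> borel_measurable lborel"
proof -
  interpret sigma_finite_measure M by fact
  define Q where "Q = {z \<in> space (lborel \<Otimes>\<^sub>M M). fst z < h (snd z)}"
  have "Q \<in> sets (lborel \<Otimes>\<^sub>M M)" unfolding Q_def by measurable
  then have "(\<lambda>\<tau>. emeasure M (Pair \<tau> -` Q)) \<in> borel_measurable lborel"
    by (rule measurable_emeasure_Pair)
  moreover have "Pair \<tau> -` Q = {x \<in> space M. \<tau> < h x}" for \<tau>
    by (auto simp: Q_def space_pair_measure)
  ultimately show ?thesis by simp
qed

lemma lborel_distr_reflect: "distr lborel borel (\<lambda>y. x - y) = (lborel :: 'a::euclidean_space measure)"
  using lborel_affine[of "- 1" x] by (simp add: density_1)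

lemma set_integral_mono_sets:
  fixes f g :: "'a \<Rightarrow> real"
  assumes "set_integrable M A f" "set_integrable M B g" "A \<subseteq> B"
    and "\<And>x. x \<in> A \<Longrightarrow> f x \<le> g x" "\<And>x. x \<in> B \<Longrightarrow> 0 \<le> g x"
  shows "(LINT x:A|M. f x) \<le> (LINT x:B|M. g x)"
  unfolding set_lebesgue_integral_def
proof (rule integral_mono)
  show "indicat_real A x *\<^sub>R f x \<le> indicat_real B x *\<^sub>R g x" for x
    using assms(3-5) by (auto simp: indicator_def)
qed (use assms(1,2) in \<open>simp_all add: set_integrable_def\<close>)

lemma set_integral_nonneg:
  fixes f :: "'a \<Rightarrow> real"
  assumes "\<And>x. x \<in> A \<Longrightarrow> 0 \<le> f x"
  shows "0 \<le> (LINT x:A|M. f x)"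
  unfolding set_lebesgue_integral_def
  by (rule Bochner_Integration.integral_nonneg) (use assms in \<open>auto simp: indicator_def\<close>)

section \<open>Differential inequalities\<close>

text \<open>At the first time \<open>t\<close> when some \<open>f x t\<close> reaches \<open>v t\<close>, the difference \<open>f x - v\<close> is negative
  just before \<open>t\<close>, which is incompatible with a negative derivative.\<close>

lemma strict_comparison:
  fixes f :: "'a::metric_space \<Rightarrow> real \<Rightarrow> real" and v :: "real \<Rightarrow> real"
  assumes K: "compact K" and ab: "a < b"
    and cf: "continuous_on (K \<times> {a..<b}) (\<lambda>(x, t). f x t)"
    and df: "\<And>x t. x \<in> K \<Longrightarrow> t \<in> {a<..<b} \<Longrightarrow> (f x has_real_derivative f' x t) (at t)"
    and cv: "continuous_on {a..<b} v"
    and dv: "\<And>t. t \<in> {a<..<b} \<Longrightarrow> (v has_real_derivative v' t) (at t)"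
    and init: "\<And>x. x \<in> K \<Longrightarrow> f x a < v a"
    and touch: "\<And>x t. x \<in> K \<Longrightarrow> t \<in> {a<..<b} \<Longrightarrow> f x t = v t \<Longrightarrow> (\<And>y. y \<in> K \<Longrightarrow> f y t \<le> f x t)
      \<Longrightarrow> f' x t < v' t"
    and x: "x \<in> K" and t: "t \<in> {a..<b}"
  shows "f x t < v t"
proof (rule ccontr)
  assume "\<not> f x t < v t"
  \<comment> \<open>The closed set of contacts and crossings; by compactness its projection to the
    time axis has a least element, the first contact time.\<close>
  define Z where "Z = {z \<in> K \<times> {a..t}. 0 \<le> (case z of (x, s) \<Rightarrow> f x s - v s)}"
  have ats: "K \<times> {a..t} \<subseteq> K \<times> {a..<b}" using t by auto
  have cont: "continuous_on (K \<times> {a..t}) (\<lambda>(x, s). f x s - v s)"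
  proof -
    have "continuous_on (K \<times> {a..t}) (\<lambda>z. v (snd z))"
      using t by (intro continuous_on_compose2[OF cv]) (auto intro!: continuous_intros)
    moreover have "continuous_on (K \<times> {a..t}) (\<lambda>z. f (fst z) (snd z))"
      using continuous_on_subset[OF cf ats] by (simp add: case_prod_unfold)
    ultimately show ?thesis by (auto simp: case_prod_unfold intro!: continuous_intros)
  qed
  have cK: "compact (K \<times> {a..t})" by (intro compact_Times K) auto
  have "closedin (top_of_set (K \<times> {a..t})) Z"
  proof -
    have "Z = (K \<times> {a..t}) \<inter> (\<lambda>(x, s). f x s - v s) -` {0..}" by (auto simp: Z_def)
    then show ?thesis using continuous_closedin_preimage[OF cont, of "{0..}"] by simp
  qed
  then have "compact Z" using cK closedin_compact by blast
  then have "compact (snd ` Z)" by (intro compact_continuous_image continuous_intros)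
  moreover have "(x, t) \<in> Z" using x t \<open>\<not> f x t < v t\<close> by (auto simp: Z_def)
  then have "snd ` Z \<noteq> {}" by auto
  ultimately obtain t1 where t1: "t1 \<in> snd ` Z" "\<And>s. s \<in> snd ` Z \<Longrightarrow> t1 \<le> s"
    using compact_attains_inf by metis
  then obtain x1 where x1: "(x1, t1) \<in> Z" by auto
  have x1K: "x1 \<in> K" "a \<le> t1" "t1 \<le> t" "f x1 t1 \<ge> v t1" using x1 by (auto simp: Z_def)
  have "t1 \<noteq> a" using x1K init[of x1] by auto
  then have t1ab: "t1 \<in> {a<..<b}" using x1K t by auto
  have a_lt: "a < t1" using t1ab by simp
  have before: "f y s < v s" if "y \<in> K" "a \<le> s" "s < t1" for y s
    using t1(2)[of s] that x1K by (force simp: Z_def)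
  \<comment> \<open>Left limits turn the strict inequality before \<open>t1\<close> into a weak one
    at \<open>t1\<close>, so the contact happens at a spatial maximum and \<open>touch\<close>
    applies.\<close>
  have le: "f y t1 \<le> v t1" if y: "y \<in> K" for y
  proof -
    have "isCont (\<lambda>s. f y s - v s) t1"
      using df[OF y t1ab] dv[OF t1ab] by (intro continuous_intros DERIV_isCont)
    then have "((\<lambda>s. f y s - v s) \<longlongrightarrow> f y t1 - v t1) (at_left t1)"
      using filterlim_at_split isCont_def by blast
    moreover have "eventually (\<lambda>s. f y s - v s \<le> 0) (at_left t1)"
      unfolding eventually_at_left[OF a_lt]
      using before[OF y] by (intro exI[of _ a]) (auto simp: a_lt less_imp_le)
    ultimately have "f y t1 - v t1 \<le> 0"
      by (intro tendsto_upperbound) auto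
    then show ?thesis by simp
  qed
  have eq: "f x1 t1 = v t1" using le[OF x1K(1)] x1K by simp
  have "f' x1 t1 < v' t1" using touch[OF x1K(1) t1ab eq] le eq by simp
  moreover have "((\<lambda>s. f x1 s - v s) has_real_derivative f' x1 t1 - v' t1) (at t1)"
    using df[OF x1K(1) t1ab] dv[OF t1ab] by (rule DERIV_diff)
  \<comment> \<open>A negative derivative makes \<open>f x1 - v\<close> positive just before
    \<open>t1\<close>, which contradicts \<open>before\<close>.\<close>
  ultimately obtain e where e: "e > 0" "\<And>h. 0 < h \<Longrightarrow> h < e \<Longrightarrow> f x1 t1 - v t1 < f x1 (t1 - h) - v (t1 - h)"
    using DERIV_neg_dec_left[of "\<lambda>s. f x1 s - v s" "f' x1 t1 - v' t1" t1] by auto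
  define h where "h = min (e/2) (t1 - a)"
  have "0 < h" "h < e" "a \<le> t1 - h" using e t1ab by (auto simp: h_def)
  with e(2)[of h] before[OF x1K(1), of "t1 - h"] eq show False by auto
qed

text \<open>Since \<open>w powr (1 - p) + (p - 1) * c * t\<close> is nonincreasing, positivity of \<open>w\<close> up to \<open>T\<close>
  bounds \<open>w\<close> from above.\<close>

lemma power_ode_upper_bound:
  fixes w w' :: "real \<Rightarrow> real"
  assumes p: "p > 1" and c: "c > 0"
    and cw: "continuous_on {0..<T} w"
    and dw: "\<And>t. t \<in> {0<..<T} \<Longrightarrow> (w has_real_derivative w' t) (at t)"
    and w0: "\<And>t. t \<in> {0..<T} \<Longrightarrow> w t \<ge> 0"
    and ineq: "\<And>t. t \<in> {0<..<T} \<Longrightarrow> w' t \<ge> c * w t powr p"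
    and t: "t \<in> {0..<T}"
  shows "w t \<le> ((p - 1) * c) powr (- 1 / (p - 1)) * (T - t) powr (- 1 / (p - 1))"
proof (cases "w t = 0")
  case False
  then have wt: "w t > 0" using w0[OF t] by simp
  \<comment> \<open>Monotonicity keeps \<open>w\<close> positive after \<open>t\<close>, so that its
    negative powers may be differentiated.\<close>
  have incr: "w t \<le> w s" if "t \<le> s" "s < T" for s
  proof (cases "t = s")
    case False
    show ?thesis
    proof (rule DERIV_nonneg_imp_increasing_open[OF that(1)])
      fix r assume "t < r" "r < s"
      then have "r \<in> {0<..<T}" using t that by auto
      then show "\<exists>y. (w has_real_derivative y) (at r) \<and> 0 \<le> y"
        using dw ineq c by (metis less_imp_le mult_nonneg_nonneg order_trans powr_ge_zero)
    qed (use t that in \<open>auto intro: continuous_on_subset[OF cw]\<close>)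
  qed auto
  have key: "(p - 1) * c * (s - t) \<le> w t powr (1 - p)" if "t < s" "s < T" for s
  proof -
    define g where "g r = w r powr (1 - p) + (p - 1) * c * r" for r
    have "g s \<le> g t"
    proof (rule DERIV_nonpos_imp_decreasing_open[of t s g])
      fix r assume r: "t < r" "r < s"
      then have rT: "r \<in> {0<..<T}" using t that by auto
      have wr: "w r > 0" using incr[of r] wt r that by auto
      have "(g has_real_derivative (1 - p) * w r powr (1 - p - 1) * w' r + (p - 1) * c) (at r)"
        unfolding g_def using DERIV_add[OF DERIV_fun_powr[OF dw[OF rT] wr, of "1 - p"]
          DERIV_cmult[OF DERIV_ident, of "(p - 1) * c" r]] by simp
      moreover have "(1 - p) * w r powr (1 - p - 1) * w' r + (p - 1) * c \<le> 0"
      proof -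
        have "w r powr (- p) * (c * w r powr p) \<le> w r powr (- p) * w' r"
          by (intro mult_left_mono ineq rT) auto
        then have "c \<le> w r powr (- p) * w' r"
          using wr by (simp add: powr_minus field_simps)
        then have "(p - 1) * c \<le> (p - 1) * (w r powr (- p) * w' r)"
          using p by (intro mult_left_mono) auto
        then show ?thesis by (simp add: algebra_simps)
      qed
      ultimately show "\<exists>y. (g has_real_derivative y) (at r) \<and> y \<le> 0" by blast
    next
      have "\<And>r. r \<in> {t..s} \<Longrightarrow> w r \<noteq> 0" using incr wt that by force
      then show "continuous_on {t..s} g"
        unfolding g_def using t that
        by (intro continuous_intros continuous_on_subset[OF cw]) auto
    qed (use that in auto)
    moreover have "w s powr (1 - p) \<ge> 0" by simp
    ultimately show ?thesis unfolding g_def right_diff_distrib by linarith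
  qed
  \<comment> \<open>The bound \<open>key\<close> holds for every \<open>s < T\<close>; let
    \<open>s\<close> tend to \<open>T\<close>.\<close>
  have "(p - 1) * c * (T - t) \<le> w t powr (1 - p)"
  proof (rule tendsto_upperbound)
    show "((\<lambda>s. (p - 1) * c * (s - t)) \<longlongrightarrow> (p - 1) * c * (T - t)) (at_left T)"
      by (intro tendsto_intros)
    show "\<forall>\<^sub>F s in at_left T. (p - 1) * c * (s - t) \<le> w t powr (1 - p)"
      using key t eventually_at_left[of t T] by auto
  qed auto
  \<comment> \<open>The exponent \<open>- 1 / (p - 1)\<close> is negative, so the inequality flips;
    it also undoes the power \<open>1 - p\<close>.\<close>
  then have "((p - 1) * c * (T - t)) powr (- 1 / (p - 1)) \<ge> (w t powr (1 - p)) powr (- 1 / (p - 1))"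
    using p c t by (intro powr_mono2') auto
  also have "(w t powr (1 - p)) powr (- 1 / (p - 1)) = w t"
  proof -
    have "(1 - p) * (- 1 / (p - 1)) = 1" using p by (simp add: field_simps)
    then show ?thesis using wt by (simp only: powr_powr powr_one)
  qed
  finally show ?thesis using p c t by (simp add: powr_mult)
qed (use p c t in auto)

text \<open>Above the level \<open>l\<close> one has \<open>u = u powr (1 - p) * u powr p\<close>,
  and the first factor is at most \<open>l powr (1 - p)\<close>. Integrated, this takes the place of
  Jensen's inequality.\<close>

lemma le_add_powr:
  fixes u l p :: real
  assumes "u \<ge> 0" "l > 0" "p > 1"
  shows "u \<le> l + l powr (1 - p) * u powr p"
proof (cases "u \<le> l")
  case True
  moreover have "l powr (1 - p) * u powr p \<ge> 0" by simp
  ultimately show ?thesis by linarith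
next
  case False
  then have "u powr (1 - p) \<le> l powr (1 - p)" using assms by (intro powr_mono2') auto
  then have "u powr (1 - p) * u powr p \<le> l powr (1 - p) * u powr p" by (intro mult_right_mono) auto
  moreover have "u powr (1 - p) * u powr p = u" using False assms by (simp flip: powr_add)
  ultimately show ?thesis using assms by linarith
qed

section \<open>Normal coordinates outside the domain\<close>

locale tubular_domain =
  fixes \<Omega> :: "'a::euclidean_space set" and \<eta> :: "'a \<Rightarrow> 'a" and s0 :: real
  assumes smooth: "smooth_domain_normal \<Omega> \<eta>"
    and tubular: "tubular_coords \<Omega> \<eta> s0"
begin

text \<open>The foot point on the boundary. The choice term is the one inside \<open>ubar\<close>,
  so that on the collar \<open>ubar\<close> becomes \<open>u\<close> composed with
  \<open>proj\<close>.\<close>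

definition proj :: "'a \<Rightarrow> 'a" where
  "proj y = (SOME z. \<exists>s. z \<in> frontier \<Omega> \<and> s \<in> {0<..<s0} \<and> y = z + s *\<^sub>R \<eta> z)"

text \<open>For \<open>r = s0\<close> this is the set covered by the normal coordinates in
  \<open>tubular_coords\<close>.\<close>

definition layer :: "real \<Rightarrow> 'a set" where
  "layer r = {y. y \<notin> closure \<Omega> \<and> infdist y \<Omega> < r}"

lemma bounded_domain: "bounded \<Omega>" and domain_nonempty: "\<Omega> \<noteq> {}"
  using smooth by (auto simp: smooth_domain_normal_def)

text \<open>By continuity \<open>\<phi>\<close> is nonpositive on the closure, and it is nonnegative
  off the open set \<open>\<Omega>\<close>; hence it vanishes on the frontier.\<close>

lemma defining_function:
  obtains \<phi> where "\<And>x. \<phi> differentiable (at x)" "\<Omega> = {x. \<phi> x < 0}"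
    "\<And>z. z \<in> frontier \<Omega> \<Longrightarrow> \<phi> z = 0 \<and> grad \<phi> z \<noteq> 0 \<and> \<eta> z = (1 / norm (grad \<phi> z)) *\<^sub>R grad \<phi> z"
    "open \<Omega>"
proof -
  from smooth obtain \<phi> where phi: "C_infinity \<phi>" "\<Omega> = {x. \<phi> x < 0}"
    "\<And>z. \<phi> z = 0 \<Longrightarrow> grad \<phi> z \<noteq> 0"
    "\<And>z. z \<in> frontier \<Omega> \<Longrightarrow> \<eta> z = (1 / norm (grad \<phi> z)) *\<^sub>R grad \<phi> z"
    unfolding smooth_domain_normal_def by blast
  have "C_k (Suc 0) \<phi>" "C_k 0 \<phi>" using phi(1) unfolding C_infinity_def by blast+
  then have diff: "\<And>x. \<phi> differentiable (at x)" and cont: "continuous_on UNIV \<phi>" by simp_all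
  have op: "open \<Omega>" unfolding phi(2) using cont by (intro open_Collect_less) auto
  have "closed {x. \<phi> x \<le> 0}" using cont by (intro closed_Collect_le) auto
  then have "closure \<Omega> \<subseteq> {x. \<phi> x \<le> 0}" by (intro closure_minimal) (auto simp: phi(2))
  then have "\<phi> z = 0" if "z \<in> frontier \<Omega>" for z
    using that op by (force simp: frontier_def interior_open phi(2))
  with that[of \<phi>] diff phi op show ?thesis by blast
qed

lemma open_domain: "open \<Omega>"
  using defining_function by metis

lemma compact_closure_domain: "compact (closure \<Omega>)"
  using bounded_domain by (simp add: compact_closure)

lemma compact_frontier: "compact (frontier \<Omega>)"
  using bounded_domain by (rule compact_frontier_bounded)

lemma frontier_subset: "frontier \<Omega> \<subseteq> closure \<Omega>"
  by (simp add: frontier_def)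

lemma frontier_nonempty: "frontier \<Omega> \<noteq> {}"
  using bounded_domain domain_nonempty by (metis frontier_eq_empty not_bounded_UNIV)

lemma norm_normal: "z \<in> frontier \<Omega> \<Longrightarrow> norm (\<eta> z) = 1"
  by (rule defining_function) auto

lemma infdist_closure_le: "a \<in> closure \<Omega> \<Longrightarrow> infdist y \<Omega> \<le> dist y a"
  by (metis infdist_le setdist_closure_2 infdist_eq_setdist)

text \<open>Lagrange multipliers: at a nearest point \<open>z\<close> of \<open>\<Omega>\<close>, every direction \<open>w\<close> entering \<open>\<Omega>\<close> makes
  an obtuse angle with \<open>y - z\<close>, so \<open>y - z\<close> is a positive multiple of the gradient.\<close>

lemma nearest_point_normal:
  assumes y: "y \<notin> closure \<Omega>" and z: "z \<in> closure \<Omega>" and dist: "dist y z = infdist y \<Omega>"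
  shows "z \<in> frontier \<Omega>" "y = z + infdist y \<Omega> *\<^sub>R \<eta> z"
proof -
  show zf: "z \<in> frontier \<Omega>"
  proof (rule ccontr)
    \<comment> \<open>From an interior point a small step towards \<open>y\<close> would stay in
      \<open>\<Omega>\<close> and come closer to \<open>y\<close>.\<close>
    assume "z \<notin> frontier \<Omega>"
    then obtain e where e: "e > 0" "ball z e \<subseteq> \<Omega>"
      using z open_domain by (metis DiffI frontier_def interior_open open_contains_ball)
    define D where "D = dist y z"
    have D: "D > 0" using y z by (auto simp: D_def)
    define t where "t = min (1/2) (e / (2 * D))"
    have t: "0 < t" "t < 1" "t * D < e" using e D by (auto simp: t_def min_def field_simps)
    have "z + t *\<^sub>R (y - z) \<in> ball z e"
      using t by (simp add: dist_norm norm_minus_commute D_def)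
    then have "z + t *\<^sub>R (y - z) \<in> \<Omega>" using e by auto
    then have "D \<le> dist y (z + t *\<^sub>R (y - z))" using dist by (simp add: D_def infdist_le)
    also have "y - (z + t *\<^sub>R (y - z)) = (1 - t) *\<^sub>R (y - z)" by (simp add: algebra_simps)
    then have "dist y (z + t *\<^sub>R (y - z)) = (1 - t) * D"
      using t by (simp add: dist_norm D_def)
    finally show False using mult_pos_pos[OF t(1) D] by (simp add: algebra_simps)
  qed
  obtain \<phi> where diff: "\<And>x. \<phi> differentiable (at x)" and om: "\<Omega> = {x. \<phi> x < 0}"
    and fr: "\<And>z. z \<in> frontier \<Omega> \<Longrightarrow> \<phi> z = 0 \<and> grad \<phi> z \<noteq> 0 \<and> \<eta> z = (1 / norm (grad \<phi> z)) *\<^sub>R grad \<phi> z"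
    using defining_function by blast
  define n where "n = grad \<phi> z"
  define e where "e = y - z"
  have n0: "n \<noteq> 0" and phiz: "\<phi> z = 0" and eta: "\<eta> z = (1 / norm n) *\<^sub>R n"
    using fr[OF zf] by (auto simp: n_def)
  have D: "(\<phi> has_derivative frechet_derivative \<phi> (at z)) (at z)"
    using diff frechet_derivative_works by blast
  have Dn: "frechet_derivative \<phi> (at z) w = n \<bullet> w" for w
  proof -
    interpret bounded_linear "frechet_derivative \<phi> (at z)" using D by (rule has_derivative_bounded_linear)
    have "frechet_derivative \<phi> (at z) w = frechet_derivative \<phi> (at z) (\<Sum>i\<in>Basis. (w \<bullet> i) *\<^sub>R i)"
      by (simp add: euclidean_representation)
    also have "\<dots> = (\<Sum>i\<in>Basis. (w \<bullet> i) * frechet_derivative \<phi> (at z) i)"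
      by (simp add: sum scaleR)
    also have "\<dots> = n \<bullet> w"
      by (simp add: n_def grad_def inner_sum_left) (simp add: inner_commute mult.commute)
    finally show ?thesis .
  qed
  \<comment> \<open>Moving from \<open>z\<close> along \<open>w\<close> makes \<open>\<phi>\<close>
    negative, so the moved points lie in \<open>\<Omega>\<close> and are no closer to
    \<open>y\<close>. Expanding the square, dividing by \<open>h\<close> and letting
    \<open>h\<close> tend to 0 gives the sign.\<close>
  have obtuse: "e \<bullet> w \<le> 0" if w: "n \<bullet> w < 0" for w
  proof -
    have "((\<lambda>\<tau>. z + \<tau> *\<^sub>R w) has_derivative (\<lambda>\<tau>. \<tau> *\<^sub>R w)) (at 0)"
      by (auto intro!: derivative_eq_intros)
    moreover have "(\<phi> has_derivative (\<lambda>w. n \<bullet> w)) (at (z + 0 *\<^sub>R w))"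
      using D ext[of "frechet_derivative \<phi> (at z)", OF Dn] by simp
    ultimately have "((\<lambda>\<tau>. \<phi> (z + \<tau> *\<^sub>R w)) has_derivative (\<lambda>\<tau>. n \<bullet> (\<tau> *\<^sub>R w))) (at 0)"
      by (rule has_derivative_compose)
    moreover have "(\<lambda>\<tau>. n \<bullet> (\<tau> *\<^sub>R w)) = (*) (n \<bullet> w)" by (simp add: fun_eq_iff mult.commute)
    ultimately have "((\<lambda>\<tau>. \<phi> (z + \<tau> *\<^sub>R w)) has_real_derivative n \<bullet> w) (at 0)"
      by (simp add: has_field_derivative_def)
    from DERIV_neg_dec_right[OF this w] obtain b where b: "b > 0"
      "\<And>h. 0 < h \<Longrightarrow> h < b \<Longrightarrow> \<phi> (z + h *\<^sub>R w) < 0" using phiz by auto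
    have "2 * (e \<bullet> w) \<le> h * (norm w)\<^sup>2" if h: "0 < h" "h < b" for h
    proof -
      have "norm e \<le> norm (e - h *\<^sub>R w)"
        using infdist_le[of "z + h *\<^sub>R w" \<Omega> y] b(2)[OF h] dist
        by (simp add: om dist_norm e_def algebra_simps)
      then have "(norm e)\<^sup>2 \<le> (norm (e - h *\<^sub>R w))\<^sup>2" by (simp add: power_mono)
      also have "(norm (e - h *\<^sub>R w))\<^sup>2 = (norm e)\<^sup>2 - h * (2 * (e \<bullet> w)) + h * (h * (norm w)\<^sup>2)"
        unfolding power2_norm_eq_inner
        by (simp add: inner_diff_left inner_diff_right inner_commute algebra_simps)
      finally have "h * (2 * (e \<bullet> w)) \<le> h * (h * (norm w)\<^sup>2)" by simp
      then show ?thesis using h by simp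
    qed
    then have "\<forall>\<^sub>F h in at_right 0. 2 * (e \<bullet> w) \<le> h * (norm w)\<^sup>2"
      unfolding eventually_at_right[OF b(1)] using b(1) by blast
    moreover have "((\<lambda>h. h * (norm w)\<^sup>2) \<longlongrightarrow> 0 * (norm w)\<^sup>2) (at_right 0)"
      by (intro tendsto_intros)
    ultimately have "2 * (e \<bullet> w) \<le> 0 * (norm w)\<^sup>2"
      by (intro tendsto_lowerbound) auto
    then show ?thesis by simp
  qed
  \<comment> \<open>Otherwise the difference of \<open>e\<close> and \<open>n\<close>, scaled to
    equal length, would point into \<open>\<Omega>\<close> and make an acute angle with
    \<open>e\<close>. Equality in Cauchy-Schwarz then makes \<open>n\<close> and \<open>e\<close>
    parallel.\<close>
  have "n \<bullet> e = norm n * norm e"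
  proof (rule ccontr)
    assume "n \<bullet> e \<noteq> norm n * norm e"
    then have lt: "n \<bullet> e < norm n * norm e" using norm_cauchy_schwarz[of n e] by linarith
    have e0: "e \<noteq> 0" using y z by (auto simp: e_def)
    define w where "w = norm n *\<^sub>R e - norm e *\<^sub>R n"
    have self: "v \<bullet> v = norm v * norm v" for v :: 'a by (simp add: dot_square_norm power2_eq_square)
    have "n \<bullet> w = norm n * (n \<bullet> e - norm n * norm e)"
      by (simp add: w_def inner_diff_right self right_diff_distrib)
    then have "n \<bullet> w < 0" using lt n0 by (simp add: mult_pos_neg)
    moreover have "e \<bullet> w = norm e * (norm n * norm e - n \<bullet> e)"
      by (simp add: w_def inner_diff_right self right_diff_distrib inner_commute[of e n])
    then have "e \<bullet> w > 0" using lt e0 by simp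
    ultimately show False using obtuse[of w] by simp
  qed
  then have "norm n *\<^sub>R e = norm e *\<^sub>R n" by (simp add: norm_cauchy_schwarz_eq)
  then have "(1 / norm n) *\<^sub>R norm n *\<^sub>R e = (1 / norm n) *\<^sub>R norm e *\<^sub>R n" by simp
  then have "e = norm e *\<^sub>R \<eta> z" using n0 by (simp add: eta)
  then show "y = z + infdist y \<Omega> *\<^sub>R \<eta> z"
    using dist by (simp add: e_def dist_norm) (metis add.commute diff_add_cancel)
qed

section \<open>Foot points and uniqueness of the normal coordinates\<close>

lemma infdist_pos: "y \<notin> closure \<Omega> \<Longrightarrow> infdist y \<Omega> > 0"
  using in_closure_iff_infdist_zero[OF domain_nonempty, of y] infdist_nonneg[of y \<Omega>] by simp

text \<open>A nearest point in the closure provides, by \<open>nearest_point_normal\<close>, a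
  second representation whose parameter is \<open>infdist\<close>. Injectivity of the coordinates
  identifies it with the given one.\<close>

lemma proj_normal_coords:
  assumes z: "z \<in> frontier \<Omega>" and s: "0 < s" "s < s0"
  shows "proj (z + s *\<^sub>R \<eta> z) = z" "infdist (z + s *\<^sub>R \<eta> z) \<Omega> = s" "z + s *\<^sub>R \<eta> z \<notin> closure \<Omega>"
proof -
  define y where "y = z + s *\<^sub>R \<eta> z"
  have img: "(\<lambda>(z, s). z + s *\<^sub>R \<eta> z) ` (frontier \<Omega> \<times> {0<..<s0}) = layer s0"
    and inj: "inj_on (\<lambda>(z, s). z + s *\<^sub>R \<eta> z) (frontier \<Omega> \<times> {0<..<s0})"
    using tubular by (auto simp: tubular_coords_def layer_def)
  have uniq: "z' = z \<and> s' = s" if "z' \<in> frontier \<Omega>" "0 < s'" "s' < s0" "y = z' + s' *\<^sub>R \<eta> z'" for z' s'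
    using inj_onD[OF inj, of "(z', s')" "(z, s)"] that(1-3) that(4)[symmetric] z s by (simp add: y_def)
  have y: "y \<in> layer s0" unfolding img[symmetric] y_def using z s by force
  then show "z + s *\<^sub>R \<eta> z \<notin> closure \<Omega>" by (simp add: layer_def y_def)
  have "\<exists>s. proj y \<in> frontier \<Omega> \<and> s \<in> {0<..<s0} \<and> y = proj y + s *\<^sub>R \<eta> (proj y)"
    unfolding proj_def by (rule someI_ex) (use z s in \<open>auto simp: y_def\<close>)
  then obtain s' where "proj y \<in> frontier \<Omega>" "0 < s'" "s' < s0" "y = proj y + s' *\<^sub>R \<eta> (proj y)" by auto
  from uniq[OF this] show "proj (z + s *\<^sub>R \<eta> z) = z" unfolding y_def by simp
  obtain z0 where z0: "z0 \<in> closure \<Omega>" "infdist y (closure \<Omega>) = dist y z0"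
    using infdist_attains_inf[of "closure \<Omega>" y] domain_nonempty by auto
  then have "dist y z0 = infdist y \<Omega>" by (simp add: infdist_eq_setdist setdist_closure_2)
  moreover have yl: "y \<notin> closure \<Omega>" "infdist y \<Omega> < s0" using y by (auto simp: layer_def)
  ultimately have "z0 \<in> frontier \<Omega>" "y = z0 + infdist y \<Omega> *\<^sub>R \<eta> z0"
    using nearest_point_normal[OF _ z0(1)] by blast+
  from uniq[OF this(1) infdist_pos[OF yl(1)] yl(2) this(2)]
  show "infdist (z + s *\<^sub>R \<eta> z) \<Omega> = s" unfolding y_def by simp
qed

lemma normal_coords:
  assumes y: "y \<in> layer s0"
  shows "proj y \<in> frontier \<Omega>" "y = proj y + infdist y \<Omega> *\<^sub>R \<eta> (proj y)" "dist (proj y) y = infdist y \<Omega>"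
proof -
  have "y \<in> (\<lambda>(z, s). z + s *\<^sub>R \<eta> z) ` (frontier \<Omega> \<times> {0<..<s0})"
    using tubular y by (auto simp: tubular_coords_def layer_def)
  then obtain z s where zs: "z \<in> frontier \<Omega>" "0 < s" "s < s0" "y = z + s *\<^sub>R \<eta> z" by auto
  have eq: "proj y = z" "infdist y \<Omega> = s" unfolding zs(4) by (rule proj_normal_coords[OF zs(1-3)])+
  show "proj y \<in> frontier \<Omega>" "y = proj y + infdist y \<Omega> *\<^sub>R \<eta> (proj y)"
    unfolding eq using zs(1,4) .
  have "dist z y = s" unfolding zs(4) using norm_normal[OF zs(1)] zs(2) by (simp add: dist_norm)
  then show "dist (proj y) y = infdist y \<Omega>" unfolding eq .
qed

section \<open>Topology and measure of the layers\<close>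

lemma layer_mono: "r \<le> r' \<Longrightarrow> layer r \<subseteq> layer r'"
  by (auto simp: layer_def)

lemma proj_frontier: "y \<in> layer r \<Longrightarrow> r \<le> s0 \<Longrightarrow> proj y \<in> frontier \<Omega>"
  by (rule normal_coords(1)) (auto simp: layer_def)

lemma proj_closure: "y \<in> layer r \<Longrightarrow> r \<le> s0 \<Longrightarrow> proj y \<in> closure \<Omega>"
  by (rule subsetD[OF frontier_subset proj_frontier])

lemma open_layer: "open (layer r)"
proof -
  have "layer r = (- closure \<Omega>) \<inter> {y. infdist y \<Omega> < r}" by (auto simp: layer_def)
  moreover have "open {y. infdist y \<Omega> < r}" by (intro open_Collect_less continuous_intros)
  ultimately show ?thesis by (simp add: open_Int open_Compl)
qed

lemma bounded_layer: "bounded (layer r)"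
proof -
  obtain b where b: "\<And>x. x \<in> closure \<Omega> \<Longrightarrow> norm x \<le> b"
    using bounded_closure[OF bounded_domain] by (auto simp: bounded_iff)
  have "norm y \<le> b + r" if y: "y \<in> layer r" for y
  proof -
    obtain z0 where z0: "z0 \<in> closure \<Omega>" "infdist y (closure \<Omega>) = dist y z0"
      using infdist_attains_inf[of "closure \<Omega>" y] domain_nonempty by auto
    then have "dist y z0 < r" using y by (simp add: infdist_eq_setdist setdist_closure_2 layer_def)
    then show ?thesis using b[OF z0(1)] norm_triangle_ineq2[of y z0] by (simp add: dist_norm)
  qed
  then show ?thesis by (auto simp: bounded_iff)
qed

lemma layer_nonempty: "0 < r \<Longrightarrow> r \<le> s0 \<Longrightarrow> layer r \<noteq> {}"
proof -
  assume r: "0 < r" "r \<le> s0"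
  obtain z where z: "z \<in> frontier \<Omega>" using frontier_nonempty by auto
  have "z + (r / 2) *\<^sub>R \<eta> z \<in> layer r"
    using proj_normal_coords[OF z, of "r/2"] r by (simp add: layer_def)
  then show ?thesis by auto
qed

lemma emeasure_layer_finite: "emeasure lborel (layer r) < \<infinity>"
  using bounded_layer by (rule emeasure_bounded_finite)

text \<open>The ball of radius \<open>s\<close> around \<open>z + s \<eta> z\<close> does not meet \<open>\<Omega>\<close> for any \<open>s < s0\<close>.\<close>

lemma inner_normal_le:
  assumes z: "z \<in> frontier \<Omega>" and a: "a \<in> closure \<Omega>" and s0: "s0 > 0"
  shows "2 * s0 * ((a - z) \<bullet> \<eta> z) \<le> (norm (a - z))\<^sup>2"
proof -
  have "2 * s * ((a - z) \<bullet> \<eta> z) \<le> (norm (a - z))\<^sup>2" if s: "0 < s" "s < s0" for s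
  proof -
    have "s \<le> dist (z + s *\<^sub>R \<eta> z) a"
      using proj_normal_coords(2)[OF z s] infdist_closure_le[OF a, of "z + s *\<^sub>R \<eta> z"] by simp
    then have "s \<le> norm ((a - z) - s *\<^sub>R \<eta> z)" by (simp add: dist_norm norm_minus_commute algebra_simps)
    then have "s\<^sup>2 \<le> (norm ((a - z) - s *\<^sub>R \<eta> z))\<^sup>2" using s by (intro power_mono) auto
    also have "\<dots> = (norm (a - z))\<^sup>2 - 2 * s * ((a - z) \<bullet> \<eta> z) + s\<^sup>2 * (norm (\<eta> z))\<^sup>2"
      unfolding power2_norm_eq_inner
      by (simp add: inner_diff_left inner_diff_right inner_commute power2_eq_square algebra_simps)
    finally show ?thesis using norm_normal[OF z] by simp
  qed
  \<comment> \<open>Only \<open>s < s0\<close> is available, so the full radius is reached by a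
    limit from the left.\<close>
  then have "\<forall>\<^sub>F s in at_left s0. 2 * s * ((a - z) \<bullet> \<eta> z) \<le> (norm (a - z))\<^sup>2"
    using s0 by (auto simp: eventually_at_left[of 0 s0])
  then show ?thesis
    by (intro tendsto_upperbound[of "\<lambda>s. 2 * s * ((a - z) \<bullet> \<eta> z)" _ "at_left s0"])
      (auto intro!: tendsto_intros)
qed

text \<open>Federer's bound for projections onto sets of positive reach.\<close>

lemma proj_lipschitz:
  assumes r: "0 < r" "r < s0" and x: "x \<in> layer r" and y: "y \<in> layer r"
  shows "dist (proj x) (proj y) \<le> s0 / (s0 - r) * dist x y"
proof -
  define z w where "z = proj x" and "w = proj y"
  define s t where "s = infdist x \<Omega>" and "t = infdist y \<Omega>"
  have xy: "x \<in> layer s0" "y \<in> layer s0" using x y r by (auto simp: layer_def)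
  have zw: "z \<in> frontier \<Omega>" "w \<in> frontier \<Omega>" "z \<in> closure \<Omega>" "w \<in> closure \<Omega>"
    using normal_coords[OF xy(1)] normal_coords[OF xy(2)] frontier_subset by (auto simp: z_def w_def)
  have eq: "x = z + s *\<^sub>R \<eta> z" "y = w + t *\<^sub>R \<eta> w"
    using normal_coords(2)[OF xy(1)] normal_coords(2)[OF xy(2)] by (auto simp: z_def w_def s_def t_def)
  have st: "0 \<le> s" "s \<le> r" "0 \<le> t" "t \<le> r" using x y by (auto simp: s_def t_def layer_def infdist_nonneg)
  define N where "N = norm (z - w)"
  have N: "(z - w) \<bullet> (z - w) = N\<^sup>2" by (simp add: N_def power2_norm_eq_inner)
  define \<alpha> \<beta> where "\<alpha> = (w - z) \<bullet> \<eta> z" and "\<beta> = (z - w) \<bullet> \<eta> w"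
  have a: "s * (2 * s0 * \<alpha>) \<le> r * N\<^sup>2"
    unfolding \<alpha>_def using inner_normal_le[OF zw(1,4)] st r
    by (intro order_trans[OF mult_left_mono mult_right_mono]) (auto simp: N_def norm_minus_commute)
  have b: "t * (2 * s0 * \<beta>) \<le> r * N\<^sup>2"
    unfolding \<beta>_def using inner_normal_le[OF zw(2,3)] st r
    by (intro order_trans[OF mult_left_mono mult_right_mono]) (auto simp: N_def)
  \<comment> \<open>Expand with \<open>x - y = (z - w) + s \<eta> z - t \<eta> w\<close>. By the
    ball condition each correction, multiplied by \<open>s0\<close>, costs at most half of
    \<open>r * N\<^sup>2\<close>.\<close>
  have "(z - w) \<bullet> (x - y) = N\<^sup>2 - s * \<alpha> - t * \<beta>"
    unfolding eq N[symmetric] \<alpha>_def \<beta>_def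
    by (simp add: inner_diff_left inner_diff_right inner_add_right inner_commute algebra_simps)
  then have "s0 * ((z - w) \<bullet> (x - y)) = s0 * N\<^sup>2 - s0 * (s * \<alpha>) - s0 * (t * \<beta>)"
    by (simp add: right_diff_distrib)
  moreover have "2 * (s0 * (s * \<alpha>)) \<le> r * N\<^sup>2" "2 * (s0 * (t * \<beta>)) \<le> r * N\<^sup>2"
    using a b by (simp_all add: mult_ac)
  ultimately have "(s0 - r) * N\<^sup>2 \<le> s0 * ((z - w) \<bullet> (x - y))"
    unfolding left_diff_distrib by linarith
  also have "\<dots> \<le> s0 * (N * dist x y)"
    using r by (intro mult_left_mono) (auto simp: N_def dist_norm norm_cauchy_schwarz)
  finally have *: "N * ((s0 - r) * N) \<le> N * (s0 * dist x y)" by (simp add: power2_eq_square algebra_simps)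
  have "(s0 - r) * N \<le> s0 * dist x y"
  proof (cases "N = 0")
    case False
    then have "N > 0" by (simp add: N_def)
    then show ?thesis using * by simp
  qed (use r in auto)
  then show ?thesis using r by (simp add: N_def dist_norm z_def w_def field_simps)
qed

section \<open>Integrals of functions of the foot point\<close>

lemma continuous_on_proj: "r < s0 \<Longrightarrow> continuous_on (layer r) proj"
proof (cases "r > 0")
  case True
  assume "r < s0"
  then have "(s0 / (s0 - r))-lipschitz_on (layer r) proj"
    using proj_lipschitz[OF True] True by (intro lipschitz_onI) auto
  then show ?thesis by (rule lipschitz_on_continuous_on)
next
  case False
  have "\<not> infdist y \<Omega> < r" for y using infdist_nonneg[of y \<Omega>] False by linarith
  then have "layer r = {}" by (auto simp: layer_def)
  then show ?thesis by simp
qed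

lemma continuous_on_comp_proj:
  assumes "r < s0" and "continuous_on (frontier \<Omega>) g"
  shows "continuous_on (layer r) (\<lambda>y. g (proj y))"
proof (rule continuous_on_compose2[OF assms(2) continuous_on_proj[OF assms(1)]])
  show "proj ` layer r \<subseteq> frontier \<Omega>"
    using proj_frontier[OF _ less_imp_le[OF assms(1)]] by (rule image_subsetI)
qed

text \<open>\<open>g\<close> is bounded on the compact frontier, and layers have finite
  measure.\<close>

lemma set_integrable_comp_proj:
  fixes g :: "'a \<Rightarrow> real"
  assumes r: "r < s0" and g: "continuous_on (frontier \<Omega>) g"
    and A: "A \<in> sets borel" "A \<subseteq> layer r"
  shows "set_integrable lborel A (\<lambda>y. g (proj y))"
proof -
  have "bounded (g ` frontier \<Omega>)"
    using compact_continuous_image[OF g compact_frontier] by (rule compact_imp_bounded)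
  then obtain B where B: "\<And>z. z \<in> frontier \<Omega> \<Longrightarrow> norm (g z) \<le> B" by (auto simp: bounded_iff)
  have "emeasure lborel A \<le> emeasure lborel (layer r)"
    using A open_layer by (intro emeasure_mono) auto
  then have fin: "emeasure lborel A < \<infinity>"
    using emeasure_layer_finite[of r] by (rule order_le_less_trans)
  have "set_integrable lborel A (\<lambda>y. B)"
    unfolding set_integrable_def using fin A by simp
  then show ?thesis
  proof (rule set_integrable_bound)
    show "set_borel_measurable lborel A (\<lambda>y. g (proj y))"
      using borel_measurable_continuous_on_indicator[OF A(1) continuous_on_subset[OF continuous_on_comp_proj[OF r g] A(2)]]
      by (simp add: set_borel_measurable_def)
    show "AE x in lborel. x \<in> A \<longrightarrow> norm (g (proj x)) \<le> norm B"
    proof (intro AE_I2 impI)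
      fix x assume "x \<in> A"
      then have "proj x \<in> frontier \<Omega>" using A r proj_frontier[of x r] by auto
      then show "norm (g (proj x)) \<le> norm B" using B by fastforce
    qed
  qed
qed

text \<open>Stretching along the normals maps \<open>layer r\<close> onto \<open>layer (k * r)\<close>, is Lipschitz and does not
  change \<open>proj\<close>.\<close>

lemma integral_layer_le:
  assumes r: "0 < r" "1 \<le> k" "k * r < s0"
  obtains C where "C \<ge> 0" "\<And>g :: 'a \<Rightarrow> real. continuous_on (frontier \<Omega>) g \<Longrightarrow>
    (\<And>z. z \<in> frontier \<Omega> \<Longrightarrow> g z \<ge> 0) \<Longrightarrow>
    (LINT y:layer (k * r)|lborel. g (proj y)) \<le> C * (LINT y:layer r|lborel. g (proj y))"
proof -
  have "1 * r \<le> k * r" using r by (intro mult_right_mono) auto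
  then have rs: "r < s0" using r by linarith
  \<comment> \<open>On the thin layer \<open>f\<close> keeps the foot point and multiplies the
    distance to \<open>\<Omega>\<close> by \<open>k\<close>.\<close>
  define f where "f y = proj y + k *\<^sub>R (y - proj y)" for y
  define A where "A = s0 / (s0 - r)"
  \<comment> \<open>Lipschitz constant of \<open>proj + k * (id - proj)\<close> when
    \<open>proj\<close> has constant \<open>A\<close>.\<close>
  define L where "L = A + k * (1 + A)"
  have "A \<ge> 0" using rs r by (simp add: A_def)
  then have L0: "L \<ge> 0" using r by (simp add: L_def)
  have flip: "dist (f x) (f y) \<le> L * dist x y" if xy: "x \<in> layer r" "y \<in> layer r" for x y
  proof -
    have p: "norm (proj x - proj y) \<le> A * dist x y"
      using proj_lipschitz[OF r(1) rs xy] by (simp add: A_def dist_norm)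
    have "f x - f y = (proj x - proj y) + k *\<^sub>R ((x - y) - (proj x - proj y))"
      by (simp add: f_def algebra_simps)
    then have "norm (f x - f y) \<le> norm (proj x - proj y) + k * norm ((x - y) - (proj x - proj y))"
      using norm_triangle_ineq[of "proj x - proj y" "k *\<^sub>R ((x - y) - (proj x - proj y))"] r by simp
    also have "\<dots> \<le> A * dist x y + k * (dist x y + A * dist x y)"
      using p r norm_triangle_ineq4[of "x - y" "proj x - proj y"]
      by (intro add_mono mult_left_mono) (auto simp: dist_norm)
    finally show ?thesis by (simp add: L_def dist_norm algebra_simps)
  qed
  have fz: "f y = proj y + (k * infdist y \<Omega>) *\<^sub>R \<eta> (proj y)" if "y \<in> layer s0" for y
    unfolding f_def using arg_cong[OF normal_coords(2)[OF that], of "\<lambda>v. v - proj y"]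
    by (simp add: scaleR_scaleR)
  have f_layer: "f y \<in> layer (k * r) \<and> proj (f y) = proj y" if y: "y \<in> layer r" for y
  proof -
    have ys: "y \<in> layer s0" using y rs layer_mono[of r s0] by auto
    have i: "0 < infdist y \<Omega>" "infdist y \<Omega> < r" using y infdist_pos[of y] by (auto simp: layer_def)
    then have "0 < k * infdist y \<Omega>" "k * infdist y \<Omega> < k * r" using r by auto
    moreover from this have "k * infdist y \<Omega> < s0" using r by linarith
    ultimately show ?thesis
      using proj_normal_coords[OF normal_coords(1)[OF ys], of "k * infdist y \<Omega>"] fz[OF ys] r
      by (auto simp: layer_def)
  qed
  have f_onto: "\<exists>x\<in>layer r. f x = y" if y: "y \<in> layer (k * r)" for y
  proof -
    have ys: "y \<in> layer s0" using y r layer_mono[of "k * r" s0] by auto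
    define z s where "z = proj y" and "s = infdist y \<Omega>"
    have z: "z \<in> frontier \<Omega>" and yz: "y = z + s *\<^sub>R \<eta> z"
      using normal_coords[OF ys] by (auto simp: z_def s_def)
    have s: "0 < s" "s < k * r" using y infdist_pos[of y] by (auto simp: layer_def s_def)
    have sk: "0 < s / k" "s / k < r" using s r by (auto simp: field_simps)
    define x where "x = z + (s / k) *\<^sub>R \<eta> z"
    have x: "proj x = z" "infdist x \<Omega> = s / k" "x \<in> layer r"
      using proj_normal_coords[OF z sk(1)] sk rs by (auto simp: x_def layer_def)
    then have "f x = y"
      using fz[of x] layer_mono[of r s0] rs r yz by auto
    then show ?thesis using x by auto
  qed
  define C where "C = unit_ball_vol (DIM('a)) * (L * DIM('a)) ^ DIM('a)"
  have C0: "C \<ge> 0" using L0 by (simp add: C_def)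
  show ?thesis
  proof (rule that[OF C0])
    fix g :: "'a \<Rightarrow> real"
    assume g: "continuous_on (frontier \<Omega>) g" and g0: "\<And>z. z \<in> frontier \<Omega> \<Longrightarrow> g z \<ge> 0"
    have meas: "(\<lambda>y. indicator (layer q) y * g (proj y)) \<in> borel_measurable lborel" if "q < s0" for q
      using borel_measurable_continuous_on_indicator[OF _ continuous_on_comp_proj[OF that g]] open_layer
      by auto
    \<comment> \<open>For \<open>\<tau> \<ge> 0\<close> the points outside the layer, where the
      product is 0, never exceed \<open>\<tau>\<close>; negative \<open>\<tau>\<close> are cut off
      by the indicator.\<close>
    have level_eq: "emeasure lborel {y \<in> space lborel. \<tau> < indicator (layer q) y * g (proj y)} * indicator {0..} \<tau>
        = emeasure lborel {y \<in> layer q. \<tau> < g (proj y)} * indicator {0..} \<tau>" for q \<tau>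
    proof (cases "\<tau> \<ge> 0")
      case True
      then have "{y \<in> space lborel. \<tau> < indicator (layer q) y * g (proj y)} = {y \<in> layer q. \<tau> < g (proj y)}"
        by (auto simp: indicator_def split: if_splits)
      then show ?thesis by simp
    qed auto
    have nn: "ennreal (LINT y:layer q|lborel. g (proj y)) =
        (\<integral>\<^sup>+\<tau>. emeasure lborel {y \<in> layer q. \<tau> < g (proj y)} * indicator {0..} \<tau> \<partial>lborel)"
      if q: "q < s0" for q
    proof -
      have "ennreal (LINT y:layer q|lborel. g (proj y)) =
          (\<integral>\<^sup>+y. ennreal (indicator (layer q) y * g (proj y)) \<partial>lborel)"
        unfolding set_lebesgue_integral_def real_scaleR_def
      proof (rule nn_integral_eq_integral[symmetric])
        show "integrable lborel (\<lambda>y. indicator (layer q) y * g (proj y))"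
          using set_integrable_comp_proj[OF q g, of "layer q"] open_layer
          by (simp add: set_integrable_def)
        have "g (proj y) \<ge> 0" if "y \<in> layer q" for y
          using g0[OF proj_frontier[OF that]] q by simp
        then show "AE y in lborel. 0 \<le> indicator (layer q) y * g (proj y)"
          by (auto simp: indicator_def)
      qed
      also have "\<dots> = (\<integral>\<^sup>+\<tau>. emeasure lborel {y \<in> space lborel. \<tau> < indicator (layer q) y * g (proj y)} * indicator {0..} \<tau> \<partial>lborel)"
        by (rule nn_integral_superlevel[OF sigma_finite_lborel meas[OF q]])
      also have "\<dots> = (\<integral>\<^sup>+\<tau>. emeasure lborel {y \<in> layer q. \<tau> < g (proj y)} * indicator {0..} \<tau> \<partial>lborel)"
        by (simp only: level_eq)
      finally show ?thesis .
    qed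
    have op: "open {y \<in> layer q. \<tau> < g (proj y)}" if "q < s0" for q \<tau>
    proof -
      have "{y \<in> layer q. \<tau> < g (proj y)} = layer q \<inter> (\<lambda>y. g (proj y)) -` {\<tau><..}" by auto
      then show ?thesis
        using continuous_on_comp_proj[OF that g] open_layer by (simp add: continuous_on_open_vimage Int_commute) 
    qed
    \<comment> \<open>Since \<open>f\<close> preserves foot points, it maps superlevel sets onto
      superlevel sets, and the layer-cake formula reduces the claim to measures of sets.\<close>
    have super: "emeasure lborel {y \<in> layer (k * r). \<tau> < g (proj y)} \<le>
        ennreal C * emeasure lborel {y \<in> layer r. \<tau> < g (proj y)}" for \<tau>
    proof -
      have img: "{y \<in> layer (k * r). \<tau> < g (proj y)} = f ` {y \<in> layer r. \<tau> < g (proj y)}"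
        using f_layer f_onto by force
      have "bounded {y \<in> layer r. \<tau> < g (proj y)}"
        using bounded_layer by (rule bounded_subset) auto
      then show ?thesis
        unfolding img C_def using op[OF rs, of \<tau>] L0 flip
        by (intro emeasure_lipschitz_image_le) auto
    qed
    have "ennreal (LINT y:layer (k * r)|lborel. g (proj y)) \<le>
        (\<integral>\<^sup>+\<tau>. ennreal C * (emeasure lborel {y \<in> layer r. \<tau> < g (proj y)} * indicator {0..} \<tau>) \<partial>lborel)"
      unfolding nn[OF r(3)] using super
      by (intro nn_integral_mono) (auto simp: indicator_def)
    also have "\<dots> = ennreal C * (\<integral>\<^sup>+\<tau>. emeasure lborel {y \<in> layer r. \<tau> < g (proj y)} * indicator {0..} \<tau> \<partial>lborel)"
    proof (rule nn_integral_cmult)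
      have "(\<lambda>\<tau>. emeasure lborel {y \<in> space lborel. \<tau> < indicator (layer r) y * g (proj y)} * indicator {0..} \<tau>)
          \<in> borel_measurable lborel"
        using borel_measurable_emeasure_superlevel[OF sigma_finite_lborel meas[OF rs]] by measurable
      also have "(\<lambda>\<tau>. emeasure lborel {y \<in> space lborel. \<tau> < indicator (layer r) y * g (proj y)} * indicator {0..} \<tau>) =
          (\<lambda>\<tau>. emeasure lborel {y \<in> layer r. \<tau> < g (proj y)} * indicator {0..} \<tau>)"
        by (simp only: level_eq)
      finally       show "(\<lambda>\<tau>. emeasure lborel {y \<in> layer r. \<tau> < g (proj y)} * indicator {0..} \<tau>) \<in> borel_measurable lborel"
.
    qed
    also have "\<dots> = ennreal C * ennreal (LINT y:layer r|lborel. g (proj y))"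
      by (simp only: nn[OF rs])
    also have "\<dots> = ennreal (C * (LINT y:layer r|lborel. g (proj y)))"
      using C0 by (simp add: ennreal_mult')
    finally show "(LINT y:layer (k * r)|lborel. g (proj y)) \<le> C * (LINT y:layer r|lborel. g (proj y))"
    proof (subst (asm) ennreal_le_iff)
      have "g (proj y) \<ge> 0" if "y \<in> layer r" for y
        using g0[OF proj_frontier[OF that]] rs by simp
      then have "(LINT y:layer r|lborel. g (proj y)) \<ge> 0"
        unfolding set_lebesgue_integral_def
        by (intro Bochner_Integration.integral_nonneg) (auto simp: indicator_def)
      then show "0 \<le> C * (LINT y:layer r|lborel. g (proj y))" using C0 by simp
    qed
  qed
qed

text \<open>The centres are taken in the layer itself, so each of the finitely many balls meets it
  in a nonempty open set, which has positive measure.\<close>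

lemma layer_finite_cover:
  assumes "0 < \<delta>"
  obtains F \<mu> where "finite F" "layer r \<subseteq> (\<Union>c\<in>F. ball c \<delta>)" "0 < \<mu>"
    "\<And>c. c \<in> F \<Longrightarrow> \<mu> \<le> measure lborel (layer r \<inter> ball c \<delta>)"
proof -
  have c: "compact (closure (layer r))" using bounded_layer by (simp add: compact_closure)
  have sub: "closure (layer r) \<subseteq> (\<Union>c\<in>layer r. ball c \<delta>)"
    using assms by (force simp: closure_approachable)
  obtain F where F: "F \<subseteq> layer r" "finite F" "closure (layer r) \<subseteq> (\<Union>c\<in>F. ball c \<delta>)"
    by (rule compactE_image[OF c _ sub]) auto
  have pos: "0 < measure lborel (layer r \<inter> ball c \<delta>)" if "c \<in> F" for c
  proof -
    have c: "c \<in> layer r \<inter> ball c \<delta>" using that F assms by auto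
    have op: "open (layer r \<inter> ball c \<delta>)" using open_layer by auto
    have "emeasure lborel (layer r \<inter> ball c \<delta>) \<noteq> \<infinity>"
      using emeasure_bounded_finite[OF bounded_subset[OF bounded_layer[of r], of "layer r \<inter> ball c \<delta>"]] by auto
    moreover have "emeasure lborel (layer r \<inter> ball c \<delta>) \<noteq> 0"
    proof
      assume "emeasure lborel (layer r \<inter> ball c \<delta>) = 0"
      then have "layer r \<inter> ball c \<delta> \<in> null_sets lborel" using op by (intro null_setsI) auto
      then have "negligible (layer r \<inter> ball c \<delta>)"
        by (simp add: negligible_iff_null_sets null_sets_completionI)
      then show False using open_not_negligible[OF op] c by blast
    qed
    ultimately show ?thesis by (simp add: measure_def enn2real_positive_iff less_top zero_less_iff_neq_zero)
  qed
  \<comment> \<open>The extra 1 keeps \<open>Min\<close> meaningful when \<open>F\<close> is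
    empty.\<close>
  define \<mu> where "\<mu> = Min (insert 1 ((\<lambda>c. measure lborel (layer r \<inter> ball c \<delta>)) ` F))"
  show ?thesis
  proof (rule that[of F \<mu>])
    show "0 < \<mu>" unfolding \<mu>_def using F pos by (subst Min_gr_iff) auto
    show "\<mu> \<le> measure lborel (layer r \<inter> ball c \<delta>)" if "c \<in> F" for c
      unfolding \<mu>_def using F that by (intro Min_le) auto
    show "layer r \<subseteq> (\<Union>c\<in>F. ball c \<delta>)" using F closure_subset by blast
  qed (use F in auto)
qed

end

section \<open>The nonlocal problem\<close>

locale nonlocal_solution = tubular_domain +
  fixes J :: "'a \<Rightarrow> real" and d p T :: real and u0 :: "'a \<Rightarrow> real" and u :: "'a \<Rightarrow> real \<Rightarrow> real"
  assumes kernel: "kernel_J J d" and d_less: "d < s0" and p_gt: "p > 1"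
    and solution: "solution_P \<Omega> J \<eta> s0 p u0 T u"
    and u0_nonneg: "\<forall>x\<in>closure \<Omega>. u0 x \<ge> 0"
begin

definition diffusion :: "'a \<Rightarrow> real \<Rightarrow> real" where
  "diffusion x t = (LINT y:\<Omega>|lborel. J (x - y) * (u y t - u x t))"

definition source :: "'a \<Rightarrow> real \<Rightarrow> real" where
  "source x t = (LINT y:(- \<Omega>)|lborel. J (x - y) * (max 0 (ubar \<Omega> \<eta> s0 u y t)) powr p)"

section \<open>The kernel, regularity of the solution and reduction of the source to a layer\<close>

lemma d_pos: "d > 0" and J_cont: "continuous_on UNIV J" and J_nonneg: "J x \<ge> 0"
  and J_integrable: "integrable lborel J" and J_integral: "(LINT x|lborel. J x) = 1"
  and J_pos: "norm x < d \<Longrightarrow> J x > 0" and J_zero: "norm x \<ge> d \<Longrightarrow> J x = 0"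
  using kernel by (auto simp: kernel_J_def)

lemma T_pos: "T > 0"
  and u_cont: "continuous_on (closure \<Omega> \<times> {0..<T}) (\<lambda>(x, t). u x t)"
  and u_init: "x \<in> closure \<Omega> \<Longrightarrow> u x 0 = u0 x"
  and u_deriv_within: "x \<in> closure \<Omega> \<Longrightarrow> t \<in> {0..<T} \<Longrightarrow>
    (u x has_real_derivative (diffusion x t + source x t)) (at t within {0..<T})"
  using solution unfolding solution_P_def diffusion_def[symmetric] source_def[symmetric] by blast+

lemma u_deriv:
  assumes "x \<in> closure \<Omega>" "t \<in> {0<..<T}"
  shows "(u x has_real_derivative (diffusion x t + source x t)) (at t)"
proof -
  have "(u x has_real_derivative (diffusion x t + source x t)) (at t within {0<..<T})"
    using u_deriv_within[OF assms(1), of t] assms(2)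
    by (auto intro: has_field_derivative_subset)
  then show ?thesis using at_within_open[OF assms(2) open_greaterThanLessThan] by simp
qed

lemma u_space_cont: "t \<in> {0..<T} \<Longrightarrow> continuous_on (closure \<Omega>) (\<lambda>x. u x t)"
  using continuous_on_compose2[OF u_cont, of "closure \<Omega>" "\<lambda>x. (x, t)"]
  by (simp add: continuous_on_Pair image_subset_iff)

lemma J_shift: "integrable lborel (\<lambda>y. J (x - y))" "(LINT y|lborel. J (x - y)) = 1"
proof -
  have m: "(\<lambda>y. x - y) \<in> measurable lborel borel" "J \<in> borel_measurable borel"
    using J_cont by (auto intro: borel_measurable_continuous_onI)
  show "integrable lborel (\<lambda>y. J (x - y))"
    using J_integrable unfolding integrable_distr_eq[OF m, symmetric] lborel_distr_reflect .
  show "(LINT y|lborel. J (x - y)) = 1"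
    using J_integral unfolding integral_distr[OF m, symmetric] lborel_distr_reflect .
qed

lemma J_set_integrable: "A \<in> sets borel \<Longrightarrow> set_integrable lborel A (\<lambda>y. J (x - y))"
  unfolding set_integrable_def by (intro integrable_mult_indicator J_shift) simp

lemma J_set_integral_le: 
  assumes "A \<in> sets borel" shows "(LINT y:A|lborel. J (x - y)) \<le> 1"
proof -
  have "(LINT y:A|lborel. J (x - y)) \<le> (LINT y|lborel. J (x - y))"
    unfolding set_lebesgue_integral_def
  proof (rule integral_mono)
    show "integrable lborel (\<lambda>y. indicator A y *\<^sub>R J (x - y))"
      using J_set_integrable[OF assms] by (simp add: set_integrable_def)
    show "indicator A y *\<^sub>R J (x - y) \<le> J (x - y)" for y
      using J_nonneg[of "x - y"] by (simp add: indicator_def)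
  qed (rule J_shift)
  then show ?thesis by (simp add: J_shift)
qed

lemma J_bounded: obtains B where "B > 0" "\<And>x. J x \<le> B"
proof -
  have "bounded (J ` cball 0 d)"
    by (intro compact_imp_bounded compact_continuous_image continuous_on_subset[OF J_cont]) auto
  then obtain B where B: "\<And>x. x \<in> cball 0 d \<Longrightarrow> \<bar>J x\<bar> \<le> B" "B > 0"
    by (auto simp: bounded_pos simp del: mem_cball mem_cball_0)
  have "J x \<le> B" for x
  proof (cases "norm x \<le> d")
    case True
    then show ?thesis using B(1)[of x] by auto
  next
    case False
    then show ?thesis using J_zero[of x] B(2) by simp
  qed
  with B(2) that show ?thesis by blast
qed

text \<open>The ball of radius \<open>d / 2\<close> is compact and lies inside the positivity set of
  \<open>J\<close>, so the minimum over it is positive.\<close>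

lemma J_lower_bound: obtains j where "j > 0" "\<And>x. norm x \<le> d / 2 \<Longrightarrow> j \<le> J x"
proof -
  have "cball (0::'a) (d / 2) \<noteq> {}" using d_pos by simp
  then obtain x0 where x0: "x0 \<in> cball 0 (d / 2)" "\<And>x. x \<in> cball 0 (d / 2) \<Longrightarrow> J x0 \<le> J x"
    using continuous_attains_inf[OF compact_cball _ continuous_on_subset[OF J_cont subset_UNIV]] by blast
  show ?thesis
    by (rule that[of "J x0"]) (use x0 J_pos[of x0] d_pos in auto)
qed

lemma ubar_eq: "ubar \<Omega> \<eta> s0 u y t = (if y \<in> layer s0 then u (proj y) t else 0)"
proof -
  have "(\<lambda>(z, s). z + s *\<^sub>R \<eta> z) ` (frontier \<Omega> \<times> {0<..<s0}) = layer s0"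
    using tubular by (auto simp: tubular_coords_def layer_def)
  then have "y \<in> layer s0 \<longleftrightarrow> y \<in> (\<lambda>(z, s). z + s *\<^sub>R \<eta> z) ` (frontier \<Omega> \<times> {0<..<s0})" by simp
  also have "\<dots> \<longleftrightarrow> (\<exists>z s. z \<in> frontier \<Omega> \<and> s \<in> {0<..<s0} \<and> y = z + s *\<^sub>R \<eta> z)"
    unfolding image_iff Bex_def by auto
  finally show ?thesis unfolding ubar_def proj_def by simp
qed

text \<open>Points of \<open>closure \<Omega>\<close> have no normal coordinates, so
  \<open>ubar\<close> takes its default 0 there, and points at distance at least \<open>d\<close>
  from \<open>\<Omega>\<close> are out of reach of \<open>J\<close>. Only \<open>layer d\<close>
  remains.\<close>

lemma source_eq:
  assumes x: "x \<in> closure \<Omega>"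
  shows "source x t = (LINT y:layer d|lborel. J (x - y) * (max 0 (u (proj y) t)) powr p)"
  unfolding source_def set_lebesgue_integral_def
proof (rule Bochner_Integration.integral_cong[OF refl])
  fix y
  consider "y \<in> layer d" | "y \<notin> layer d" "y \<in> closure \<Omega>" | "y \<notin> layer d" "y \<notin> closure \<Omega>" by blast
  then show "indicat_real (- \<Omega>) y *\<^sub>R (J (x - y) * max 0 (ubar \<Omega> \<eta> s0 u y t) powr p) =
      indicat_real (layer d) y *\<^sub>R (J (x - y) * max 0 (u (proj y) t) powr p)"
  proof cases
    case 1
    then have "y \<notin> \<Omega>" "y \<in> layer s0" using d_less closure_subset[of \<Omega>] by (auto simp: layer_def)
    then show ?thesis using 1 by (simp add: ubar_eq)
  next
    case 2
    then have "y \<notin> layer s0" by (simp add: layer_def)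
    then show ?thesis using 2 by (simp add: ubar_eq)
  next
    case 3
    then have "d \<le> dist y x" using infdist_closure_le[OF x, of y] by (simp add: layer_def)
    then have "J (x - y) = 0" using J_zero[of "x - y"] by (simp add: dist_norm norm_minus_commute)
    then show ?thesis by simp
  qed
qed

section \<open>Signs of the two terms and nonnegativity of the solution\<close>

lemma source_nonneg: "source x t \<ge> 0"
  unfolding source_def by (rule set_integral_nonneg) (simp add: J_nonneg)

lemma diffusion_nonpos:
  assumes "\<And>y. y \<in> closure \<Omega> \<Longrightarrow> u y t \<le> u x t" shows "diffusion x t \<le> 0"
proof -
  have "0 \<le> (LINT y:\<Omega>|lborel. - (J (x - y) * (u y t - u x t)))"
  proof (rule set_integral_nonneg)
    fix y assume "y \<in> \<Omega>"
    then have "u y t \<le> u x t" using assms closure_subset by auto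
    then show "0 \<le> - (J (x - y) * (u y t - u x t))"
      using J_nonneg[of "x - y"] by (simp add: mult_nonneg_nonpos)
  qed
  then show ?thesis by (simp add: diffusion_def set_lebesgue_integral_def)
qed

lemma diffusion_nonneg:
  assumes "\<And>y. y \<in> closure \<Omega> \<Longrightarrow> u x t \<le> u y t" shows "diffusion x t \<ge> 0"
  unfolding diffusion_def
proof (rule set_integral_nonneg)
  fix y assume "y \<in> \<Omega>"
  then have "u x t \<le> u y t" using assms closure_subset by auto
  then show "0 \<le> J (x - y) * (u y t - u x t)" using J_nonneg[of "x - y"] by simp
qed

text \<open>Minimum principle: at a spatial minimum the diffusion is nonnegative, and the source
  always is, so \<open>u\<close> cannot cross a slowly falling negative barrier.\<close>

lemma u_nonneg:
  assumes x: "x \<in> closure \<Omega>" and t: "t \<in> {0..<T}"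
  shows "u x t \<ge> 0"
proof -
  \<comment> \<open>The barrier \<open>e * (1 + t)\<close> is positive at time 0 and has slope
    \<open>e\<close>, which makes both the initial and the touching inequality strict. Afterwards
    \<open>e\<close> tends to 0.\<close>
  have "- u x t < e * (1 + t)" if e: "e > 0" for e
  proof (rule strict_comparison[of "closure \<Omega>" 0 T "\<lambda>x t. - u x t" "\<lambda>x t. - (diffusion x t + source x t)"
        "\<lambda>t. e * (1 + t)" "\<lambda>t. e"])
    show "compact (closure \<Omega>)" by (rule compact_closure_domain)
    show "continuous_on (closure \<Omega> \<times> {0..<T}) (\<lambda>(x, t). - u x t)"
      using continuous_on_minus[OF u_cont] by (simp add: case_prod_unfold)
    show "((\<lambda>t. - u x t) has_real_derivative - (diffusion x t + source x t)) (at t)"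
      if "x \<in> closure \<Omega>" "t \<in> {0<..<T}" for x t
      using u_deriv[OF that] by (rule DERIV_minus)
    show "- u x 0 < e * (1 + 0)" if "x \<in> closure \<Omega>" for x
      using u_init[OF that] u0_nonneg that e by force
    show "- (diffusion x t + source x t) < e"
      if "\<And>y. y \<in> closure \<Omega> \<Longrightarrow> - u y t \<le> - u x t" for x t
      using diffusion_nonneg[of x t] source_nonneg[of x t] that e by force
  qed (use x t T_pos in \<open>auto intro!: continuous_intros derivative_eq_intros\<close>)
  then have lim: "\<forall>\<^sub>F e in at_right 0. - u x t \<le> e * (1 + t)"
    unfolding eventually_at_right[OF zero_less_one] using zero_less_one less_imp_le by blast
  have "((\<lambda>e. e * (1 + t)) \<longlongrightarrow> 0 * (1 + t)) (at_right 0)" by (intro tendsto_intros)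
  from tendsto_lowerbound[OF this lim] show ?thesis by simp
qed

lemma u_frontier_cont: "t \<in> {0..<T} \<Longrightarrow> continuous_on (frontier \<Omega>) (\<lambda>z. u z t)"
  by (rule continuous_on_subset[OF u_space_cont frontier_subset])

lemma powr_cont: "t \<in> {0..<T} \<Longrightarrow> continuous_on (frontier \<Omega>) (\<lambda>z. u z t powr p)"
proof (rule continuous_on_powr'[OF u_frontier_cont continuous_on_const])
  assume t: "t \<in> {0..<T}"
  then show "\<forall>z\<in>frontier \<Omega>. 0 \<le> u z t \<and> (u z t = 0 \<longrightarrow> 0 < p)"
    using u_nonneg[OF subsetD[OF frontier_subset] t] p_gt by simp
qed

lemma u_proj_nonneg: "y \<in> layer d \<Longrightarrow> t \<in> {0..<T} \<Longrightarrow> u (proj y) t \<ge> 0"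
  using u_nonneg[OF proj_closure[OF _ less_imp_le[OF d_less]]] .

section \<open>Bounds for the source and the diffusion\<close>

lemma source_eq_powr:
  assumes x: "x \<in> closure \<Omega>" and t: "t \<in> {0..<T}"
  shows "source x t = (LINT y:layer d|lborel. J (x - y) * u (proj y) t powr p)"
  unfolding source_eq[OF x] set_lebesgue_integral_def
proof (rule Bochner_Integration.integral_cong[OF refl])
  show "indicat_real (layer d) y *\<^sub>R (J (x - y) * max 0 (u (proj y) t) powr p) =
      indicat_real (layer d) y *\<^sub>R (J (x - y) * u (proj y) t powr p)" for y
    using u_proj_nonneg[of y t] t by (simp add: indicator_def)
qed

lemma set_integrable_J_comp_proj:
  fixes g :: "'a \<Rightarrow> real"
  assumes A: "A \<in> sets borel" "A \<subseteq> layer d" and g: "continuous_on (frontier \<Omega>) g"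
  shows "set_integrable lborel A (\<lambda>y. J (x - y) * g (proj y))"
proof -
  obtain B where B: "B > 0" "\<And>x. J x \<le> B" using J_bounded by blast
  have "set_integrable lborel A (\<lambda>y. B * g (proj y))"
    using set_integrable_comp_proj[OF d_less g A] by simp
  then show ?thesis
  proof (rule set_integrable_bound)
    have "continuous_on A (\<lambda>y. g (proj y))"
      by (rule continuous_on_subset[OF continuous_on_comp_proj[OF d_less g] A(2)])
    moreover have "continuous_on A (\<lambda>y. J (x - y))"
      by (intro continuous_on_compose2[OF J_cont] continuous_intros) auto
    ultimately have "continuous_on A (\<lambda>y. J (x - y) * g (proj y))" by (rule continuous_on_mult[rotated])
    from borel_measurable_continuous_on_indicator[OF A(1) this]
    show "set_borel_measurable lborel A (\<lambda>y. J (x - y) * g (proj y))"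
      by (simp add: set_borel_measurable_def)
    have "J (x - y) * \<bar>g (proj y)\<bar> \<le> B * \<bar>g (proj y)\<bar>" for y
      by (rule mult_right_mono[OF B(2)]) simp
    then show "AE y in lborel. y \<in> A \<longrightarrow> norm (J (x - y) * g (proj y)) \<le> norm (B * g (proj y))"
      using B(1) J_nonneg by (simp add: abs_mult)
  qed
qed

text \<open>Pull the bound out of the integral; what is left is at most the total mass 1 of
  \<open>J\<close>.\<close>

lemma source_le_powr:
  assumes x: "x \<in> closure \<Omega>" and t: "t \<in> {0..<T}"
    and V: "\<And>y. y \<in> closure \<Omega> \<Longrightarrow> u y t \<le> V"
  shows "source x t \<le> V powr p"
proof -
  have L: "layer d \<in> sets borel" using open_layer by simp
  have "source x t \<le> (LINT y:layer d|lborel. V powr p * J (x - y))"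
    unfolding source_eq_powr[OF x t]
  proof (rule set_integral_mono)
    show "set_integrable lborel (layer d) (\<lambda>y. J (x - y) * u (proj y) t powr p)"
      by (rule set_integrable_J_comp_proj[OF L subset_refl powr_cont[OF t]])
    show "set_integrable lborel (layer d) (\<lambda>y. V powr p * J (x - y))"
      using J_set_integrable[OF L] by simp
    fix y assume y: "y \<in> layer d"
    have "u (proj y) t powr p \<le> V powr p"
      using V[OF proj_closure[OF y]] u_proj_nonneg[OF y t] d_less p_gt by (intro powr_mono2) auto
    from mult_left_mono[OF this J_nonneg[of "x - y"]]
    show "J (x - y) * u (proj y) t powr p \<le> V powr p * J (x - y)" by (simp add: mult.commute)
  qed
  also have "\<dots> = V powr p * (LINT y:layer d|lborel. J (x - y))" by simp
  also have "\<dots> \<le> V powr p * 1" by (intro mult_left_mono J_set_integral_le L) simp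
  finally show ?thesis by simp
qed

lemma source_le_integral:
  assumes B: "\<And>x. J x \<le> B" and x: "x \<in> closure \<Omega>" and t: "t \<in> {0..<T}"
  shows "source x t \<le> B * (LINT y:layer d|lborel. u (proj y) t powr p)"
proof -
  have L: "layer d \<in> sets borel" using open_layer by simp
  have "source x t \<le> (LINT y:layer d|lborel. B * u (proj y) t powr p)"
    unfolding source_eq_powr[OF x t]
  proof (rule set_integral_mono)
    show "set_integrable lborel (layer d) (\<lambda>y. J (x - y) * u (proj y) t powr p)"
      by (rule set_integrable_J_comp_proj[OF L subset_refl powr_cont[OF t]])
    show "set_integrable lborel (layer d) (\<lambda>y. B * u (proj y) t powr p)"
      using set_integrable_comp_proj[OF d_less powr_cont[OF t] L] by simp
    show "J (x - y) * u (proj y) t powr p \<le> B * u (proj y) t powr p" for y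
      by (rule mult_right_mono[OF B]) simp
  qed
  then show ?thesis by simp
qed

lemma source_ge_integral:
  assumes x: "x \<in> closure \<Omega>" and t: "t \<in> {0..<T}" and j: "j \<ge> 0"
    and A: "A \<in> sets borel" "A \<subseteq> layer d" and J: "\<And>y. y \<in> A \<Longrightarrow> j \<le> J (x - y)"
  shows "j * (LINT y:A|lborel. u (proj y) t powr p) \<le> source x t"
proof -
  have L: "layer d \<in> sets borel" using open_layer by simp
  have "(LINT y:A|lborel. j * u (proj y) t powr p) \<le> source x t"
    unfolding source_eq_powr[OF x t]
  proof (rule set_integral_mono_sets)
    show "set_integrable lborel A (\<lambda>y. j * u (proj y) t powr p)"
      using set_integrable_comp_proj[OF d_less powr_cont[OF t] A] by simp
    show "set_integrable lborel (layer d) (\<lambda>y. J (x - y) * u (proj y) t powr p)"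
      by (rule set_integrable_J_comp_proj[OF L subset_refl powr_cont[OF t]])
    show "j * u (proj y) t powr p \<le> J (x - y) * u (proj y) t powr p" if "y \<in> A" for y
      by (rule mult_right_mono[OF J[OF that]]) simp
    show "0 \<le> J (x - y) * u (proj y) t powr p" for y by (simp add: J_nonneg)
  qed (rule A)
  then show ?thesis by simp
qed

lemma diffusion_integrable:
  assumes x: "x \<in> closure \<Omega>" and t: "t \<in> {0..<T}"
  shows "set_integrable lborel \<Omega> (\<lambda>y. J (x - y) * (u y t - u x t))"
proof -
  have Om: "\<Omega> \<in> sets borel" using open_domain by simp
  have "bounded ((\<lambda>y. u y t) ` closure \<Omega>)"
    by (intro compact_imp_bounded compact_continuous_image u_space_cont t compact_closure_domain)
  then obtain M where M: "\<And>y. y \<in> closure \<Omega> \<Longrightarrow> \<bar>u y t\<bar> \<le> M" by (auto simp: bounded_iff)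
  have "set_integrable lborel \<Omega> (\<lambda>y. (2 * M) * J (x - y))"
    using J_set_integrable[OF Om] by simp
  then show ?thesis
  proof (rule set_integrable_bound)
    have "continuous_on \<Omega> (\<lambda>y. u y t - u x t)"
      by (intro continuous_intros continuous_on_subset[OF u_space_cont[OF t]] closure_subset)
    moreover have "continuous_on \<Omega> (\<lambda>y. J (x - y))"
      by (intro continuous_on_compose2[OF J_cont] continuous_intros) auto
    ultimately have "continuous_on \<Omega> (\<lambda>y. J (x - y) * (u y t - u x t))" by (rule continuous_on_mult[rotated])
    from borel_measurable_continuous_on_indicator[OF Om this]
    show "set_borel_measurable lborel \<Omega> (\<lambda>y. J (x - y) * (u y t - u x t))"
      by (simp add: set_borel_measurable_def)
    show "AE y in lborel. y \<in> \<Omega> \<longrightarrow> norm (J (x - y) * (u y t - u x t)) \<le> norm (2 * M * J (x - y))"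
    proof (intro AE_I2 impI)
      fix y assume "y \<in> \<Omega>"
      then have "\<bar>u y t - u x t\<bar> \<le> \<bar>2 * M\<bar>" using M[of y] M[OF x] closure_subset[of \<Omega>] by force
      then have "J (x - y) * \<bar>u y t - u x t\<bar> \<le> J (x - y) * \<bar>2 * M\<bar>"
        by (rule mult_left_mono[OF _ J_nonneg])
      then show "norm (J (x - y) * (u y t - u x t)) \<le> norm (2 * M * J (x - y))"
        using J_nonneg[of "x - y"] by (simp add: abs_mult mult_ac)
    qed
  qed
qed

text \<open>The kernel integrates to at most 1 over \<open>\<Omega>\<close>. The lower bound drops
  the gain \<open>J (x - y) * u y t\<close>, the upper bound drops the loss; both are
  nonnegative.\<close>

lemma diffusion_bounds:
  assumes x: "x \<in> closure \<Omega>" and t: "t \<in> {0..<T}"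
  shows "- u x t \<le> diffusion x t"
    and "(\<And>y. y \<in> closure \<Omega> \<Longrightarrow> u y t \<le> V) \<Longrightarrow> diffusion x t \<le> V"
proof -
  have Om: "\<Omega> \<in> sets borel" using open_domain by simp
  have "(LINT y:\<Omega>|lborel. (- u x t) * J (x - y)) \<le> diffusion x t"
    unfolding diffusion_def
  proof (rule set_integral_mono)
    fix y assume "y \<in> \<Omega>"
    then have "u y t \<ge> 0" using u_nonneg[OF _ t] closure_subset by auto
    then have "0 \<le> J (x - y) * u y t" by (simp add: J_nonneg)
    then show "- u x t * J (x - y) \<le> J (x - y) * (u y t - u x t)" by (simp add: algebra_simps)
  qed (use set_integrable_mult_right[of "- u x t" lborel \<Omega> "\<lambda>y. J (x - y)"] J_set_integrable[OF Om]
      diffusion_integrable[OF x t] in blast)+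
  moreover have "u x t * (LINT y:\<Omega>|lborel. J (x - y)) \<le> u x t * 1"
    by (intro mult_left_mono J_set_integral_le Om u_nonneg x t)
  moreover have "(LINT y:\<Omega>|lborel. (- u x t) * J (x - y)) = - (u x t * (LINT y:\<Omega>|lborel. J (x - y)))"
    by (subst set_integral_mult_right) simp
  ultimately show "- u x t \<le> diffusion x t" by linarith
  assume V: "\<And>y. y \<in> closure \<Omega> \<Longrightarrow> u y t \<le> V"
  have V0: "V \<ge> 0" using V[OF x] u_nonneg[OF x t] by simp
  have "diffusion x t \<le> (LINT y:\<Omega>|lborel. V * J (x - y))"
    unfolding diffusion_def
  proof (rule set_integral_mono)
    fix y assume "y \<in> \<Omega>"
    then have "u y t - u x t \<le> V" using V[of y] closure_subset[of \<Omega>] u_nonneg[OF x t] by force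
    then have "J (x - y) * (u y t - u x t) \<le> J (x - y) * V" by (rule mult_left_mono[OF _ J_nonneg])
    then show "J (x - y) * (u y t - u x t) \<le> V * J (x - y)" by (simp add: mult.commute)
  qed (use J_set_integrable[OF Om] diffusion_integrable[OF x t] in simp_all)
  moreover have "V * (LINT y:\<Omega>|lborel. J (x - y)) \<le> V * 1"
    by (intro mult_left_mono J_set_integral_le Om V0)
  ultimately show "diffusion x t \<le> V" by simp
qed

section \<open>Mass in a thin layer\<close>

definition mass :: "real \<Rightarrow> real \<Rightarrow> real" where
  "mass r t = (LINT y:layer r|lborel. u (proj y) t)"

definition power_mass :: "real \<Rightarrow> real \<Rightarrow> real" where
  "power_mass r t = (LINT y:layer r|lborel. u (proj y) t powr p)"

lemma power_mass_nonneg: "power_mass r t \<ge> 0"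
  unfolding power_mass_def by (rule set_integral_nonneg) simp

lemma mass_nonneg: "r \<le> d \<Longrightarrow> t \<in> {0..<T} \<Longrightarrow> mass r t \<ge> 0"
  unfolding mass_def using layer_mono[of r d] by (intro set_integral_nonneg u_proj_nonneg) auto

text \<open>Up to a time \<open>S < T\<close> the solution is bounded by compactness. This supplies
  the dominating constant for differentiation under the integral.\<close>

lemma velocity_bounded:
  assumes "S < T"
  obtains B where "\<And>x t. x \<in> closure \<Omega> \<Longrightarrow> t \<in> {0..S} \<Longrightarrow> \<bar>diffusion x t + source x t\<bar> \<le> B"
proof -
  have "bounded ((\<lambda>(x, t). u x t) ` (closure \<Omega> \<times> {0..S}))"
    using assms by (intro compact_imp_bounded compact_continuous_image continuous_on_subset[OF u_cont]
      compact_Times compact_closure_domain) auto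
  then obtain M where M: "\<And>z. z \<in> (\<lambda>(x, t). u x t) ` (closure \<Omega> \<times> {0..S}) \<Longrightarrow> norm z \<le> M"
    unfolding bounded_iff by blast
  have u_le: "u y t \<le> M" if "y \<in> closure \<Omega>" "t \<in> {0..S}" for y t
    using M[of "u y t"] that by (simp add: image_iff) (metis SigmaI abs_le_D1 case_prod_conv atLeastAtMost_iff)
  show ?thesis
  proof (rule that[of "M + M powr p"])
    fix x t assume x: "x \<in> closure \<Omega>" and t: "t \<in> {0..S}"
    then have tT: "t \<in> {0..<T}" using assms by simp
    have "- M \<le> diffusion x t" using diffusion_bounds(1)[OF x tT] u_le[OF x t] by linarith
    moreover have "diffusion x t \<le> M" by (rule diffusion_bounds(2)[OF x tT u_le[OF _ t]])
    moreover have "source x t \<le> M powr p" by (rule source_le_powr[OF x tT u_le[OF _ t]])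
    moreover have "0 \<le> source x t" by (rule source_nonneg)
    moreover have "0 \<le> M powr p" by simp
    ultimately show "\<bar>diffusion x t + source x t\<bar> \<le> M + M powr p" unfolding abs_le_iff by linarith
  qed
qed

text \<open>Dominated convergence for the difference quotients, which are bounded by the mean value
  theorem.\<close>

lemma mass_deriv:
  assumes r: "r \<le> d" and t: "t \<in> {0..<T}"
  shows "set_integrable lborel (layer r) (\<lambda>y. diffusion (proj y) t + source (proj y) t)"
    and "(mass r has_real_derivative (LINT y:layer r|lborel. diffusion (proj y) t + source (proj y) t))
      (at t within {0..<T})"
proof -
  \<comment> \<open>An intermediate time: \<open>{0..S}\<close> contains a neighbourhood of
    \<open>t\<close> relative to \<open>{0..<T}\<close>, and velocities are bounded on it.\<close>
  define S where "S = (t + T) / 2"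
  have S: "t < S" "S < T" using t by (auto simp: S_def)
  obtain B where B: "\<And>x t. x \<in> closure \<Omega> \<Longrightarrow> t \<in> {0..S} \<Longrightarrow> \<bar>diffusion x t + source x t\<bar> \<le> B"
    using velocity_bounded[OF S(2)] by blast
  have rs: "r < s0" using r d_less by simp
  have L: "layer r \<in> sets borel" using open_layer by simp
  have cl: "proj y \<in> closure \<Omega>" if "y \<in> layer r" for y
    by (rule proj_closure[OF that less_imp_le[OF rs]])
  define v where "v x = diffusion x t + source x t" for x
  \<comment> \<open>Limits are tested along sequences, to which dominated convergence applies; it
    yields integrability of the limit as well.\<close>
  have main: "set_integrable lborel (layer r) (\<lambda>y. v (proj y))
      \<and> (\<lambda>i. (mass r (X i) - mass r t) / (X i - t)) \<longlonglongrightarrow> (LINT y:layer r|lborel. v (proj y))"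
    if X: "\<And>i. X i \<in> {0..<S} - {t}" "X \<longlonglongrightarrow> t" for X :: "nat \<Rightarrow> real"
  proof -
    have XT: "X i \<in> {0..<T} - {t}" for i using X(1)[of i] S by auto
    define Q where "Q i x = (u x (X i) - u x t) / (X i - t)" for i x
    have Qint: "set_integrable lborel (layer r) (\<lambda>y. Q i (proj y))" for i
    proof (rule set_integrable_comp_proj[OF rs _ L subset_refl])
      have "X i \<noteq> t" "X i \<in> {0..<T}" using XT[of i] by auto
      then show "continuous_on (frontier \<Omega>) (Q i)"
        unfolding Q_def using t by (intro continuous_intros u_frontier_cont) auto
    qed
    have Qlim: "(\<lambda>i. Q i x) \<longlonglongrightarrow> v x" if "x \<in> closure \<Omega>" for x
    proof -
      have "((\<lambda>s. (u x s - u x t) / (s - t)) \<longlongrightarrow> v x) (at t within {0..<T})"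
        using u_deriv_within[OF that t] by (simp add: has_field_derivative_iff v_def)
      then have "((\<lambda>s. (u x s - u x t) / (s - t)) \<circ> X) \<longlonglongrightarrow> v x"
        using XT X(2) unfolding tendsto_at_iff_sequentially by blast
      then show ?thesis by (simp add: Q_def comp_def)
    qed
    have Qbound: "\<bar>Q i x\<bar> \<le> B" if x: "x \<in> closure \<Omega>" for i x
    proof -
      have "norm (u x (X i) - u x t) \<le> B * norm (X i - t)"
      proof (rule field_differentiable_bound[of "{0..S}" "u x" "\<lambda>s. diffusion x s + source x s"])
        show "(u x has_field_derivative diffusion x s + source x s) (at s within {0..S})"
          if s: "s \<in> {0..S}" for s
        proof (rule has_field_derivative_subset[OF u_deriv_within[OF x]])
          show "s \<in> {0..<T}" "{0..S} \<subseteq> {0..<T}" using s S by auto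
        qed
        show "norm (diffusion x s + source x s) \<le> B" if "s \<in> {0..S}" for s
          using B[OF x that] by simp
        show "X i \<in> {0..S}" "t \<in> {0..S}" using X(1)[of i] t S by auto
      qed simp
      then show ?thesis using XT[of i] by (simp add: Q_def abs_divide pos_divide_le_eq)
    qed
    define s where "s i y = indicat_real (layer r) y *\<^sub>R Q i (proj y)" for i y
    define f where "f y = indicat_real (layer r) y *\<^sub>R v (proj y)" for y
    have s_meas: "s i \<in> borel_measurable lborel" for i
      using Qint[of i] unfolding set_integrable_def s_def by (rule borel_measurable_integrable)
    have s_lim: "(\<lambda>i. s i y) \<longlonglongrightarrow> f y" for y
    proof (cases "y \<in> layer r")
      case True
      then show ?thesis using Qlim[OF cl[OF True]] by (simp add: s_def f_def)
    qed (simp add: s_def f_def)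
    have f_meas: "f \<in> borel_measurable lborel"
      by (rule borel_measurable_LIMSEQ_metric[OF s_meas s_lim])
    have w: "integrable lborel (\<lambda>y. indicat_real (layer r) y * B)"
      using L emeasure_layer_finite[of r] by (intro integrable_mult_left) (simp add: integrable_indicator_iff)
    have bound: "norm (s i y) \<le> indicat_real (layer r) y * B" for i y
    proof (cases "y \<in> layer r")
      case True
      then show ?thesis using Qbound[OF cl[OF True]] by (simp add: s_def)
    qed (simp add: s_def)
    note dc = f_meas s_meas w AE_I2[OF s_lim] AE_I2[OF bound]
    have "integrable lborel f" by (rule integrable_dominated_convergence[OF dc])
    moreover have "(\<lambda>i. integral\<^sup>L lborel (s i)) \<longlonglongrightarrow> integral\<^sup>L lborel f"
      by (rule integral_dominated_convergence[OF dc])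
    moreover have "integral\<^sup>L lborel (s i) = (mass r (X i) - mass r t) / (X i - t)" for i
    proof -
      have "X i \<in> {0..<T}" using XT[of i] by simp
      have "integral\<^sup>L lborel (s i) = (LINT y:layer r|lborel. Q i (proj y))"
        by (simp add: s_def[abs_def] set_lebesgue_integral_def)
      also have "\<dots> = (LINT y:layer r|lborel. u (proj y) (X i) - u (proj y) t) / (X i - t)"
        unfolding Q_def by (rule set_integral_divide_zero)
      also have "(LINT y:layer r|lborel. u (proj y) (X i) - u (proj y) t) = mass r (X i) - mass r t"
        unfolding mass_def
        by (intro set_integral_diff(2) set_integrable_comp_proj[OF rs _ L subset_refl] u_frontier_cont t) fact
      finally show ?thesis .
    qed
    ultimately show ?thesis by (simp add: f_def[abs_def] set_integrable_def set_lebesgue_integral_def)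
  qed
  \<comment> \<open>Integrability comes out of \<open>main\<close> only through a sequence, so one
    approaching \<open>t\<close> from the right is exhibited.\<close>
  define X0 where "X0 i = t + (S - t) / 2 * inverse (real (Suc i))" for i
  have "X0 i \<in> {0..<S} - {t}" for i
  proof -
    define q where "q = (S - t) / 2 * inverse (real (Suc i))"
    have "inverse (real (Suc i)) \<le> 1" by (simp add: field_simps)
    then have "q \<le> (S - t) / 2 * 1"
      unfolding q_def using S by (intro mult_left_mono) auto
    moreover have "0 < q" using S by (simp add: q_def)
    ultimately have "t + q \<in> {0..<S} - {t}" using S t by auto
    then show ?thesis by (simp only: X0_def q_def)
  qed
  moreover have "X0 \<longlonglongrightarrow> t + (S - t) / 2 * 0"
    unfolding X0_def by (intro tendsto_intros LIMSEQ_inverse_real_of_nat)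
  then have "X0 \<longlonglongrightarrow> t" by simp
  ultimately show "set_integrable lborel (layer r) (\<lambda>y. diffusion (proj y) t + source (proj y) t)"
    using main[of X0] unfolding v_def by blast
  have "at t within {0..<T} = at t within {0..<S}"
    by (rule at_within_nhd[of t "{..<S}"]) (use S in auto)
  moreover have "((\<lambda>s. (mass r s - mass r t) / (s - t)) \<longlongrightarrow> (LINT y:layer r|lborel. v (proj y))) (at t within {0..<S})"
    unfolding tendsto_at_iff_sequentially comp_def using main by blast
  ultimately show "(mass r has_real_derivative (LINT y:layer r|lborel. diffusion (proj y) t + source (proj y) t))
      (at t within {0..<T})"
    by (simp add: has_field_derivative_iff v_def)
qed

text \<open>Jensen's inequality up to a factor \<open>2 powr p\<close>. Splitting at half the mean
  value, the part at the level \<open>l\<close> accounts for only half of the mass.\<close>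

lemma mass_powr_le:
  assumes r: "0 < r" "r \<le> d" and t: "t \<in> {0..<T}"
  defines "V \<equiv> measure lborel (layer r)"
  shows "V * (mass r t / (2 * V)) powr p \<le> power_mass r t" and "V > 0"
proof -
  have L: "layer r \<in> sets lborel" using open_layer by simp
  have fin: "emeasure lborel (layer r) \<noteq> \<infinity>" using emeasure_layer_finite[of r] by simp
  have rs: "r < s0" using r d_less by simp
  have "\<not> negligible (layer r)"
    using open_not_negligible[OF open_layer] layer_nonempty[of r] r rs by simp
  then have "emeasure lborel (layer r) \<noteq> 0"
    using L by (auto simp: negligible_iff_null_sets intro: null_sets_completionI null_setsI)
  then show V0: "V > 0"
    using fin unfolding V_def by (simp add: measure_def enn2real_positive_iff less_top zero_less_iff_neq_zero)
  define l where "l = mass r t / (2 * V)"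
  show "V * (mass r t / (2 * V)) powr p \<le> power_mass r t"
  proof (cases "mass r t = 0")
    case True
    then show ?thesis using power_mass_nonneg by simp
  next
    case False
    then have m: "mass r t > 0" using mass_nonneg[OF r(2) t] by simp
    then have l: "l > 0" using V0 by (simp add: l_def)
    have int: "set_integrable lborel (layer r) (\<lambda>y. l powr (1 - p) * u (proj y) t powr p)"
      using set_integrable_comp_proj[OF rs powr_cont[OF t] L[simplified] subset_refl] by simp
    have int': "set_integrable lborel (layer r) (\<lambda>y. l)"
      using L fin by (simp add: set_integrable_def integrable_indicator_iff less_top)
    have "mass r t \<le> (LINT y:layer r|lborel. l + l powr (1 - p) * u (proj y) t powr p)"
      unfolding mass_def
    proof (rule set_integral_mono)
      show "set_integrable lborel (layer r) (\<lambda>y. u (proj y) t)"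
        by (rule set_integrable_comp_proj[OF rs u_frontier_cont[OF t] L[simplified] subset_refl])
      show "set_integrable lborel (layer r) (\<lambda>y. l + l powr (1 - p) * u (proj y) t powr p)"
        by (rule set_integral_add(1)[OF int' int])
      fix y assume "y \<in> layer r"
      then have "u (proj y) t \<ge> 0" using u_proj_nonneg[of y t] layer_mono[OF r(2)] t by auto
      then show "u (proj y) t \<le> l + l powr (1 - p) * u (proj y) t powr p"
        by (rule le_add_powr[OF _ l p_gt])
    qed
    also have "\<dots> = V * l + l powr (1 - p) * power_mass r t"
      unfolding set_integral_add(2)[OF int' int] set_integral_mult_right power_mass_def
        set_integral_const[OF L fin] V_def by simp
    \<comment> \<open>One half of the mass cancels, the other half has to be paid for by the power
      integral.\<close>
    also have "mass r t = V * l + V * l" using V0 by (simp add: l_def)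
    finally have "V * l \<le> l powr (1 - p) * power_mass r t" by simp
    then have "l powr (p - 1) * (V * l) \<le> l powr (p - 1) * (l powr (1 - p) * power_mass r t)"
      by (intro mult_left_mono) auto
    also have "\<dots> = power_mass r t" using l by (simp flip: mult.assoc powr_add)
    also have "l powr (p - 1) * (V * l) = V * l powr p"
      using l by (simp add: powr_diff)
    finally show ?thesis by (simp add: l_def)
  qed
qed

text \<open>Stretching by the factor 4 leads from the layer of width \<open>d / 4\<close>, where the
  mass is tracked, to that of width \<open>d\<close>, which carries the whole source.\<close>

lemma power_mass_layer_le:
  obtains C where "C \<ge> 0" "\<And>t. t \<in> {0..<T} \<Longrightarrow> power_mass d t \<le> C * power_mass (d / 4) t"
proof -
  have "0 < d / 4" "1 \<le> (4::real)" "4 * (d / 4) < s0" using d_pos d_less by auto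
  from integral_layer_le[OF this] obtain C where C: "C \<ge> 0"
    "\<And>g :: 'a \<Rightarrow> real. continuous_on (frontier \<Omega>) g \<Longrightarrow> (\<And>z. z \<in> frontier \<Omega> \<Longrightarrow> g z \<ge> 0) \<Longrightarrow>
      (LINT y:layer (4 * (d / 4))|lborel. g (proj y)) \<le> C * (LINT y:layer (d / 4)|lborel. g (proj y))"
    by blast
  have "power_mass d t \<le> C * power_mass (d / 4) t" if "t \<in> {0..<T}" for t
    using C(2)[OF powr_cont[OF that]] by (simp add: power_mass_def)
  with C(1) that show ?thesis by blast
qed

text \<open>Within a ball of radius \<open>d / 8\<close> all pairs \<open>proj x\<close>, \<open>y\<close> are closer than \<open>d / 2\<close>, where \<open>J\<close> is
  bounded below; summing over a finite cover by such balls replaces a double integral.\<close>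

lemma mass_growth:
  obtains c where "c > 0" "\<And>t. t \<in> {0..<T} \<Longrightarrow>
    c * power_mass (d / 4) t \<le> (LINT y:layer (d / 4)|lborel. diffusion (proj y) t + source (proj y) t) + mass (d / 4) t"
proof -
  define N where "N = layer (d / 4)"
  have N: "N \<in> sets borel" using open_layer by (simp add: N_def)
  have Nd: "N \<subseteq> layer d" using layer_mono[of "d / 4" d] d_pos by (simp add: N_def)
  have rs: "d / 4 < s0" using d_less d_pos by simp
  obtain j where j: "j > 0" "\<And>x. norm x \<le> d / 2 \<Longrightarrow> j \<le> J x" using J_lower_bound by blast
  have "0 < d / 8" using d_pos by simp
  from layer_finite_cover[OF this, of "d / 4"] obtain F \<mu> where F: "finite F" "N \<subseteq> (\<Union>c\<in>F. ball c (d / 8))"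
    and \<mu>: "0 < \<mu>" "\<And>c. c \<in> F \<Longrightarrow> \<mu> \<le> measure lborel (N \<inter> ball c (d / 8))"
    unfolding N_def by blast
  have "N \<noteq> {}" using layer_nonempty[of "d / 4"] d_pos rs by (simp add: N_def)
  then have "F \<noteq> {}" using F(2) by auto
  then have cF: "0 < real (card F)" using F(1) by (simp add: card_gt_0_iff)
  show ?thesis
  \<comment> \<open>\<open>j\<close> bounds the kernel from below, \<open>\<mu>\<close> the measure
    of each piece, and summing over the cover costs the factor \<open>card F\<close>.\<close>
  proof (rule that[of "j * \<mu> / card F"])
    show "0 < j * \<mu> / card F" using j(1) \<mu>(1) cF by simp
    fix t assume t: "t \<in> {0..<T}"
    define h where "h y = u (proj y) t powr p" for y
    \<comment> \<open>Adding \<open>u\<close> compensates the largest possible diffusion loss, so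
      \<open>G\<close> dominates the source and is nonnegative.\<close>
    define G where "G y = diffusion (proj y) t + source (proj y) t + u (proj y) t" for y
    have int1: "set_integrable lborel N (\<lambda>y. diffusion (proj y) t + source (proj y) t)"
      unfolding N_def by (rule mass_deriv(1)) (use t d_pos in auto)
    have int2: "set_integrable lborel N (\<lambda>y. u (proj y) t)"
      unfolding N_def by (rule set_integrable_comp_proj[OF rs u_frontier_cont[OF t] N[unfolded N_def] subset_refl])
    have G_int: "set_integrable lborel N G" unfolding G_def by (rule set_integral_add(1)[OF int1 int2])
    have h_int: "set_integrable lborel A h" if "A \<in> sets borel" "A \<subseteq> N" for A
      unfolding h_def by (rule set_integrable_comp_proj[OF rs powr_cont[OF t] that(1) that(2)[unfolded N_def]])
    have cl: "proj y \<in> closure \<Omega>" if "y \<in> N" for y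
      using proj_closure[of y "d / 4"] that rs by (simp add: N_def)
    have G_source: "source (proj y) t \<le> G y" if "y \<in> N" for y
      using diffusion_bounds(1)[OF cl[OF that] t] by (simp add: G_def)
    have G0: "0 \<le> G y" if "y \<in> N" for y
      using G_source[OF that] source_nonneg by (rule order_trans[rotated])
    have ball: "j * \<mu> * (LINT y:N \<inter> ball c (d / 8)|lborel. h y) \<le> (LINT y:N|lborel. G y)"
      if c: "c \<in> F" for c
    proof -
      define A where "A = N \<inter> ball c (d / 8)"
      have A: "A \<in> sets borel" "A \<subseteq> N" "A \<subseteq> layer d" using N Nd by (auto simp: A_def)
      define P where "P = (LINT y:A|lborel. h y)"
      have P0: "P \<ge> 0" unfolding P_def h_def by (rule set_integral_nonneg) simp
      have fin: "emeasure lborel A \<noteq> \<infinity>"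
        using emeasure_bounded_finite[OF bounded_subset[OF bounded_layer A(3)]] by simp
      \<comment> \<open>On \<open>A\<close> the integrand is at least the constant
        \<open>j * P\<close>; integrating over \<open>A\<close> multiplies it by a measure of at
        least \<open>\<mu>\<close>.\<close>
      have "j * P \<le> G x" if x: "x \<in> A" for x
      proof -
        have xN: "x \<in> N" using x A by auto
        have "j \<le> J (proj x - y)" if y: "y \<in> A" for y
        proof (rule j(2))
          have "x \<in> layer s0" using xN layer_mono[of "d/4" s0] rs by (auto simp: N_def)
          \<comment> \<open>The three distances add up to
            \<open>d / 4 + d / 8 + d / 8 = d / 2\<close>.\<close>
          then have "dist (proj x) x < d / 4"
            using normal_coords(3) xN by (simp add: N_def layer_def)
          moreover have "dist x y \<le> dist x c + dist c y" by (rule dist_triangle)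
          moreover have "dist x c < d / 8" "dist c y < d / 8" using x y by (simp_all add: A_def dist_commute)
          moreover have "dist (proj x) y \<le> dist (proj x) x + dist x y" by (rule dist_triangle)
          ultimately show "norm (proj x - y) \<le> d / 2" unfolding dist_norm by linarith
        qed
        then have "j * P \<le> source (proj x) t"
          unfolding P_def h_def using j(1) by (intro source_ge_integral[OF cl[OF xN] t _ A(1,3)]) auto
        then show ?thesis using G_source[OF xN] by simp
      qed
      then have "(LINT y:A|lborel. j * P) \<le> (LINT y:N|lborel. G y)"
        using A G0 G_int fin
        by (intro set_integral_mono_sets) (auto simp: set_integrable_def integrable_indicator_iff less_top)
      moreover have "(LINT y:A|lborel. j * P) = measure lborel A * (j * P)"
        using A(1) fin by (simp add: set_integral_const)
      moreover have "\<mu> * (j * P) \<le> measure lborel A * (j * P)"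
        using \<mu>(2)[OF c] P0 j(1) by (intro mult_right_mono) (auto simp: A_def)
      ultimately have "\<mu> * (j * P) \<le> (LINT y:N|lborel. G y)" by linarith
      moreover have "\<mu> * (j * P) = j * \<mu> * P" by simp
      ultimately show ?thesis unfolding P_def A_def by linarith
    qed
    have "power_mass (d / 4) t = (LINT y:N|lborel. h y)" by (simp add: power_mass_def h_def N_def)
    \<comment> \<open>The balls may overlap, but \<open>h\<close> is nonnegative and each point of
      \<open>N\<close> lies in at least one of them.\<close>
    also have "\<dots> \<le> (\<integral>y. (\<Sum>c\<in>F. indicat_real (N \<inter> ball c (d / 8)) y *\<^sub>R h y) \<partial>lborel)"
      unfolding set_lebesgue_integral_def
    proof (rule integral_mono)
      show "integrable lborel (\<lambda>y. indicat_real N y *\<^sub>R h y)"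
        using h_int[OF N subset_refl] by (simp add: set_integrable_def)
      show "integrable lborel (\<lambda>y. \<Sum>c\<in>F. indicat_real (N \<inter> ball c (d / 8)) y *\<^sub>R h y)"
      proof (rule Bochner_Integration.integrable_sum)
        show "integrable lborel (\<lambda>y. indicat_real (N \<inter> ball c (d / 8)) y *\<^sub>R h y)" for c
          using h_int[of "N \<inter> ball c (d / 8)"] N by (simp add: set_integrable_def)
      qed
      fix y
      have h0: "h y \<ge> 0" by (simp add: h_def)
      show "indicat_real N y *\<^sub>R h y \<le> (\<Sum>c\<in>F. indicat_real (N \<inter> ball c (d / 8)) y *\<^sub>R h y)"
      proof (cases "y \<in> N")
        case True
        then obtain c where c: "c \<in> F" "y \<in> ball c (d / 8)" using F(2) by blast
        have "indicat_real (N \<inter> ball c (d / 8)) y *\<^sub>R h y \<le> (\<Sum>c\<in>F. indicat_real (N \<inter> ball c (d / 8)) y *\<^sub>R h y)"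
          using c(1) F(1) h0 by (intro member_le_sum) auto
        then show ?thesis using True c(2) by simp
      qed (use h0 in \<open>auto intro!: sum_nonneg\<close>)
    qed
    also have "\<dots> = (\<Sum>c\<in>F. LINT y:N \<inter> ball c (d / 8)|lborel. h y)"
      unfolding set_lebesgue_integral_def
    proof (rule Bochner_Integration.integral_sum)
      show "integrable lborel (\<lambda>y. indicat_real (N \<inter> ball c (d / 8)) y *\<^sub>R h y)" for c
        using h_int[of "N \<inter> ball c (d / 8)"] N by (simp add: set_integrable_def)
    qed
    finally have "j * \<mu> * power_mass (d / 4) t \<le> j * \<mu> * (\<Sum>c\<in>F. LINT y:N \<inter> ball c (d / 8)|lborel. h y)"
      using j(1) \<mu>(1) by (intro mult_left_mono) auto
    also have "\<dots> = (\<Sum>c\<in>F. j * \<mu> * (LINT y:N \<inter> ball c (d / 8)|lborel. h y))"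
      by (rule sum_distrib_left)
    also have "\<dots> \<le> (\<Sum>c\<in>F. LINT y:N|lborel. G y)" by (rule sum_mono[OF ball])
    also have "\<dots> = card F * (LINT y:N|lborel. G y)" by simp
    also have "(LINT y:N|lborel. G y) =
        (LINT y:N|lborel. diffusion (proj y) t + source (proj y) t) + (LINT y:N|lborel. u (proj y) t)"
      unfolding G_def by (rule set_integral_add(2)[OF int1 int2])
    finally show "j * \<mu> / card F * power_mass (d / 4) t \<le>
        (LINT y:layer (d / 4)|lborel. diffusion (proj y) t + source (proj y) t) + mass (d / 4) t"
      using cF by (simp add: N_def mass_def field_simps)
  qed
qed

section \<open>The blow-up rate\<close>

lemma blow_up_rate_upper:
  obtains C where "\<And>x t. x \<in> closure \<Omega> \<Longrightarrow> t \<in> {0..<T} \<Longrightarrow> u x t \<le> C * (T - t) powr (- 1 / (p - 1))"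
proof -
  define m where "m = mass (d / 4)"
  define R where "R t = (LINT y:layer (d / 4)|lborel. diffusion (proj y) t + source (proj y) t)" for t
  define V where "V = measure lborel (layer (d / 4))"
  have d4: "0 < d / 4" "d / 4 \<le> d" using d_pos by auto
  obtain B where B: "B > 0" "\<And>x. J x \<le> B" using J_bounded by blast
  obtain A where A: "A \<ge> 0" "\<And>t. t \<in> {0..<T} \<Longrightarrow> power_mass d t \<le> A * power_mass (d / 4) t"
    using power_mass_layer_le by blast
  obtain c where c: "c > 0" "\<And>t. t \<in> {0..<T} \<Longrightarrow> c * power_mass (d / 4) t \<le> R t + m t"
    unfolding m_def R_def using mass_growth by blast
  have "0 \<in> {0..<T}" using T_pos by simp
  then have V0: "V > 0" unfolding V_def by (rule mass_powr_le(2)[OF d4])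
  have m0: "m t \<ge> 0" if "t \<in> {0..<T}" for t unfolding m_def by (rule mass_nonneg[OF d4(2) that])
  \<comment> \<open>The weight \<open>exp t\<close> absorbs the loss \<open>- m t\<close>: the
    derivative involves only \<open>R t + m t\<close>, which \<open>mass_growth\<close> bounds from
    below.\<close>
  define w where "w t = exp t * m t" for t
  define w' where "w' t = exp t * (R t + m t)" for t
  have w0: "w t \<ge> 0" if "t \<in> {0..<T}" for t using m0[OF that] by (simp add: w_def)
  have m_deriv: "(m has_real_derivative R t) (at t within {0..<T})" if "t \<in> {0..<T}" for t
    unfolding m_def R_def by (rule mass_deriv(2)[OF d4(2) that])
  have w_deriv: "(w has_real_derivative w' t) (at t within {0..<T})" if "t \<in> {0..<T}" for t
    unfolding w_def w'_def using m_deriv[OF that]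
    by (auto intro!: derivative_eq_intros simp: algebra_simps)
  have w_cont: "continuous_on {0..<T} w"
    using w_deriv by (rule DERIV_continuous_on)
  have w_deriv': "(w has_real_derivative w' t) (at t)" if "t \<in> {0<..<T}" for t
  proof -
    have "(w has_real_derivative w' t) (at t within {0<..<T})"
      by (rule has_field_derivative_subset[OF w_deriv]) (use that in auto)
    then show ?thesis using at_within_open[OF that open_greaterThanLessThan] by simp
  qed
  \<comment> \<open>Used twice: for the differential inequality of \<open>w\<close>, and to bound
    the source by \<open>w'\<close>.\<close>
  have w'_ge: "c * power_mass (d / 4) t \<le> w' t" if t: "t \<in> {0..<T}" for t
  proof -
    have "0 \<le> c * power_mass (d / 4) t" using c(1) power_mass_nonneg by simp
    then have "1 * (c * power_mass (d / 4) t) \<le> exp t * (R t + m t)"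
      using t by (intro mult_mono c(2)) auto
    then show ?thesis by (simp add: w'_def)
  qed
  \<comment> \<open>Since \<open>m t = exp (- t) * w t\<close> is at least
    \<open>exp (- T) * w t\<close>, this choice gives
    \<open>a * w t \<le> m t / (2 * V)\<close>.\<close>
  define a where "a = exp (- T) / (2 * V)"
  have a0: "a > 0" using V0 by (simp add: a_def)
  define k where "k = c * (V * a powr p)"
  have k0: "k > 0" using c(1) V0 a0 by (simp add: k_def)
  have ode: "k * w t powr p \<le> w' t" if t: "t \<in> {0<..<T}" for t
  proof -
    have t': "t \<in> {0..<T}" using t by simp
    have "exp (- T) * w t = exp (t - T) * m t" by (simp add: w_def exp_diff exp_minus divide_inverse)
    also have "\<dots> \<le> 1 * m t" using t m0[OF t'] by (intro mult_right_mono) auto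
    finally have "a * w t \<le> m t / (2 * V)" using V0 by (simp add: a_def divide_right_mono)
    then have "(a * w t) powr p \<le> (m t / (2 * V)) powr p"
      using a0 w0[OF t'] p_gt by (intro powr_mono2) auto
    then have "a powr p * w t powr p \<le> (m t / (2 * V)) powr p"
      using a0 w0[OF t'] by (simp add: powr_mult)
    then have "V * (a powr p * w t powr p) \<le> V * (m t / (2 * V)) powr p"
      using V0 by (intro mult_left_mono) auto
    also have "\<dots> \<le> power_mass (d / 4) t" unfolding V_def m_def by (rule mass_powr_le(1)[OF d4 t'])
    finally have "c * (V * (a powr p * w t powr p)) \<le> c * power_mass (d / 4) t"
      using c(1) by (intro mult_left_mono) auto
    also have "\<dots> \<le> w' t" by (rule w'_ge[OF t'])
    finally show ?thesis by (simp add: k_def mult.assoc)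
  qed
  define q where "q = - 1 / (p - 1)"
  define K where "K = ((p - 1) * k) powr q"
  have w_le: "w t \<le> K * (T - t) powr q" if "t \<in> {0..<T}" for t
    unfolding K_def q_def by (rule power_ode_upper_bound[OF p_gt k0 w_cont w_deriv' w0 ode that])
  have "bounded ((\<lambda>x. u x 0) ` closure \<Omega>)"
    using T_pos by (intro compact_imp_bounded compact_continuous_image u_space_cont compact_closure_domain) auto
  then obtain S where S: "S > 0" "\<And>x. x \<in> closure \<Omega> \<Longrightarrow> \<bar>u x 0\<bar> \<le> S"
    by (auto simp: bounded_pos)
  \<comment> \<open>Collects the kernel bound \<open>B\<close>, the layer comparison
    \<open>A\<close> and the growth constant \<open>c\<close>, so that the source is at most
    \<open>\<kappa> * w'\<close>.\<close>
  define \<kappa> where "\<kappa> = B * A / c"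
  have \<kappa>0: "\<kappa> \<ge> 0" using A B c by (simp add: \<kappa>_def)
  \<comment> \<open>At a spatial maximum the diffusion is nonpositive and the source is at most the
    slope of \<open>\<kappa> * w\<close>; the term with \<open>e\<close> makes the comparison
    strict.\<close>
  have compare: "u x t < S + \<kappa> * w t + e * (1 + t)"
    if e: "e > 0" and x: "x \<in> closure \<Omega>" and t: "t \<in> {0..<T}" for e x t
  proof (rule strict_comparison[OF compact_closure_domain T_pos u_cont u_deriv, of "\<lambda>t. S + \<kappa> * w t + e * (1 + t)"
        "\<lambda>t. \<kappa> * w' t + e"])
    show "continuous_on {0..<T} (\<lambda>t. S + \<kappa> * w t + e * (1 + t))"
      by (intro continuous_intros w_cont)
    show "((\<lambda>t. S + \<kappa> * w t + e * (1 + t)) has_real_derivative \<kappa> * w' t + e) (at t)" if "t \<in> {0<..<T}" for t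
      using w_deriv'[OF that] by (auto intro!: derivative_eq_intros)
    show "u x 0 < S + \<kappa> * w 0 + e * (1 + 0)" if x: "x \<in> closure \<Omega>" for x
    proof -
      have "0 \<le> \<kappa> * w 0" using \<kappa>0 w0[of 0] T_pos by simp
      moreover have "u x 0 \<le> S" using S(2)[OF x] by simp
      ultimately show ?thesis using e by simp
    qed
    show "diffusion x t + source x t < \<kappa> * w' t + e"
      if x: "x \<in> closure \<Omega>" and t: "t \<in> {0<..<T}" and max: "\<And>y. y \<in> closure \<Omega> \<Longrightarrow> u y t \<le> u x t" for x t
    proof -
      have t': "t \<in> {0..<T}" using t by simp
      have "source x t \<le> B * power_mass d t"
        unfolding power_mass_def by (rule source_le_integral[OF B(2) x t'])
      also have "\<dots> \<le> B * (A * power_mass (d / 4) t)"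
        using A(2)[OF t'] B(1) by (intro mult_left_mono) auto
      also have "\<dots> = \<kappa> * (c * power_mass (d / 4) t)" using c(1) by (simp add: \<kappa>_def)
      also have "\<dots> \<le> \<kappa> * w' t" by (rule mult_left_mono[OF w'_ge[OF t'] \<kappa>0])
      finally show ?thesis using diffusion_nonpos[OF max] e by simp
    qed
  qed (use x t in auto)
  show ?thesis
  \<comment> \<open>The bounded part \<open>S\<close> is absorbed into the rate: \<open>q\<close> is
    negative, so \<open>T powr q \<le> (T - t) powr q\<close>.\<close>
  proof (rule that[of "S / T powr q + \<kappa> * K"])
    fix x t assume x: "x \<in> closure \<Omega>" and t: "t \<in> {0..<T}"
    have "u x t \<le> S + \<kappa> * w t"
    proof (rule field_le_epsilon)
      fix e :: real assume e: "e > 0"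
      have "u x t < S + \<kappa> * w t + e / (1 + t) * (1 + t)" by (rule compare) (use e x t in auto)
      then show "u x t \<le> S + \<kappa> * w t + e" using t by simp
    qed
    also have "\<kappa> * w t \<le> \<kappa> * (K * (T - t) powr q)" by (rule mult_left_mono[OF w_le[OF t] \<kappa>0])
    also have "S = S / T powr q * T powr q" using T_pos by simp
    also have "S / T powr q * T powr q \<le> S / T powr q * (T - t) powr q"
      using S(1) t p_gt by (intro mult_left_mono powr_mono2') (auto simp: q_def)
    finally show "u x t \<le> (S / T powr q + \<kappa> * K) * (T - t) powr (- 1 / (p - 1))"
      by (simp add: q_def algebra_simps)
  qed
qed

section \<open>The lower rate\<close>

text \<open>Below the rate, \<open>u\<close> stays under a solution of \<open>v' = \<kappa> v powr p\<close> with \<open>\<kappa> > 1\<close> that lives beyond \<open>T\<close>.\<close>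

lemma bounded_below_rate:
  assumes t0: "t0 \<in> {0..<T}" and M: "0 \<le> M" "\<And>x. x \<in> closure \<Omega> \<Longrightarrow> u x t0 \<le> M"
    and rate: "M < ((p - 1) * (T - t0)) powr (- 1 / (p - 1))"
  obtains V where "\<And>x t. x \<in> closure \<Omega> \<Longrightarrow> t \<in> {t0..<T} \<Longrightarrow> u x t \<le> V"
proof -
  define q where "q = - 1 / (p - 1)"
  have q: "q < 0" "q * (1 - p) = 1" "q * p = q - 1" "- q * (p - 1) = 1"
    using p_gt by (auto simp: q_def field_simps)
  define X where "X = (p - 1) * (T - t0)"
  have X0: "X > 0" using t0 p_gt by (simp add: X_def)
  \<comment> \<open>The gap between \<open>M\<close> and the critical value lets the barrier start
    at \<open>r > M\<close> and still exist beyond \<open>T\<close>.\<close>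
  obtain r where r: "M < r" "r < X powr q"
    using dense[OF rate] by (auto simp: X_def q_def)
  have r0: "r > 0" using r M by simp
  define Y where "Y = r powr (1 - p)"
  have "(X powr q) powr (1 - p) < Y"
    unfolding Y_def using r r0 p_gt by (intro powr_less_mono2_neg) auto
  then have Y: "X < Y" using X0 q(2) by (simp add: powr_powr)
  \<comment> \<open>\<open>\<kappa> * X\<close> is the midpoint of \<open>X\<close> and
    \<open>Y\<close>, which gives \<open>\<kappa> > 1\<close> and still leaves
    \<open>Y - \<kappa> * X\<close> positive.\<close>
  define \<kappa> where "\<kappa> = (Y + X) / (2 * X)"
  have \<kappa>: "\<kappa> > 1" "\<kappa> * X < Y" using X0 Y by (auto simp: \<kappa>_def field_simps)
  \<comment> \<open>Linear in time so that \<open>b t powr q\<close> solves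
    \<open>v' = \<kappa> * v powr p\<close> with the value \<open>r\<close> at
    \<open>t0\<close>.\<close>
  define b where "b t = Y - (p - 1) * \<kappa> * (t - t0)" for t
  have b: "Y - \<kappa> * X \<le> b t" "0 < b t" if "t \<in> {t0..<T}" for t
  proof -
    have "(p - 1) * \<kappa> * (t - t0) \<le> (p - 1) * \<kappa> * (T - t0)"
      using that p_gt \<kappa>(1) by (intro mult_left_mono) auto
    then show "Y - \<kappa> * X \<le> b t" by (simp add: b_def X_def mult_ac)
    then show "0 < b t" using \<kappa>(2) by simp
  qed
  \<comment> \<open>At a maximum touching the barrier the source is at most
    \<open>b t powr (q - 1)\<close>, because \<open>q * p = q - 1\<close>; the factor
    \<open>\<kappa> > 1\<close> makes this strict.\<close>
  have less: "u x t < b t powr q" if x: "x \<in> closure \<Omega>" and t: "t \<in> {t0..<T}" for x t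
  proof (rule strict_comparison[of "closure \<Omega>" t0 T u "\<lambda>x t. diffusion x t + source x t" "\<lambda>t. b t powr q"
        "\<lambda>t. \<kappa> * b t powr (q - 1)"])
    show "compact (closure \<Omega>)" by (rule compact_closure_domain)
    show "continuous_on (closure \<Omega> \<times> {t0..<T}) (\<lambda>(x, t). u x t)"
      by (rule continuous_on_subset[OF u_cont]) (use t0 in auto)
    show "(u x has_real_derivative diffusion x t + source x t) (at t)"
      if "x \<in> closure \<Omega>" "t \<in> {t0<..<T}" for x t
      by (rule u_deriv) (use that t0 in auto)
    show "continuous_on {t0..<T} (\<lambda>t. b t powr q)"
    proof (rule continuous_on_powr)
      show "continuous_on {t0..<T} b" unfolding b_def by (intro continuous_intros)
      show "\<forall>t\<in>{t0..<T}. b t \<noteq> 0" using b(2) by force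
    qed (rule continuous_on_const)
    show "((\<lambda>t. b t powr q) has_real_derivative \<kappa> * b t powr (q - 1)) (at t)" if "t \<in> {t0<..<T}" for t
    proof -
      have bt: "b t > 0" using b(2)[of t] that by simp
      have "(b has_real_derivative - ((p - 1) * \<kappa>)) (at t)"
        unfolding b_def by (auto intro!: derivative_eq_intros)
      from DERIV_fun_powr[OF this bt, of q]
      have "((\<lambda>t. b t powr q) has_real_derivative q * b t powr (q - 1) * - ((p - 1) * \<kappa>)) (at t)" by simp
      moreover have "q * b t powr (q - 1) * - ((p - 1) * \<kappa>) = (- q * (p - 1)) * (\<kappa> * b t powr (q - 1))"
        by (simp add: algebra_simps)
      ultimately show ?thesis by (simp only: q(4) mult_1)
    qed
    show "u x t0 < b t0 powr q" if x: "x \<in> closure \<Omega>" for x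
    proof -
      have "b t0 powr q = r" using r0 q(2) by (simp add: b_def Y_def powr_powr mult.commute)
      then show ?thesis using M(2)[OF x] r(1) by simp
    qed
    show "diffusion x t + source x t < \<kappa> * b t powr (q - 1)"
      if x: "x \<in> closure \<Omega>" and t: "t \<in> {t0<..<T}" and eq: "u x t = b t powr q"
        and max: "\<And>y. y \<in> closure \<Omega> \<Longrightarrow> u y t \<le> u x t" for x t
    proof -
      have bt: "b t > 0" using b(2)[of t] t by simp
      have "source x t \<le> u x t powr p" by (rule source_le_powr[OF x _ max]) (use t t0 in auto)
      also have "\<dots> = b t powr (q - 1)" unfolding eq powr_powr q(3) ..
      finally have "source x t \<le> b t powr (q - 1)" .
      moreover have "b t powr (q - 1) < \<kappa> * b t powr (q - 1)" using \<kappa>(1) bt by simp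
      ultimately show ?thesis using diffusion_nonpos[OF max] by linarith
    qed
  qed (use x t t0 in auto)
  show ?thesis
  proof (rule that[of "(Y - \<kappa> * X) powr q"])
    fix x t assume x: "x \<in> closure \<Omega>" and t: "t \<in> {t0..<T}"
    have "b t powr q \<le> (Y - \<kappa> * X) powr q"
      using b(1)[OF t] \<kappa>(2) q(1) by (intro powr_mono2') auto
    then show "u x t \<le> (Y - \<kappa> * X) powr q" using less[OF x t] by simp
  qed
qed

text \<open>The supremum runs over the open set only; continuity carries its bound to the closure,
  where the comparison arguments take place.\<close>

lemma Linf_norm_bounds:
  assumes t: "t \<in> {0..<T}"
  shows "x \<in> closure \<Omega> \<Longrightarrow> u x t \<le> Linf_norm \<Omega> u t" and "0 \<le> Linf_norm \<Omega> u t"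
    and "(\<And>x. x \<in> closure \<Omega> \<Longrightarrow> u x t \<le> V) \<Longrightarrow> Linf_norm \<Omega> u t \<le> V"
proof -
  have "bounded ((\<lambda>x. u x t) ` closure \<Omega>)"
    by (intro compact_imp_bounded compact_continuous_image u_space_cont t compact_closure_domain)
  then obtain b where b: "\<And>x. x \<in> closure \<Omega> \<Longrightarrow> \<bar>u x t\<bar> \<le> b" by (auto simp: bounded_iff)
  have bdd: "bdd_above ((\<lambda>x. \<bar>u x t\<bar>) ` \<Omega>)"
    using b closure_subset by (intro bdd_aboveI[of _ b]) auto
  have le: "\<bar>u x t\<bar> \<le> Linf_norm \<Omega> u t" if "x \<in> \<Omega>" for x
    unfolding Linf_norm_def by (rule cSUP_upper[OF that bdd])
  show "u x t \<le> Linf_norm \<Omega> u t" if "x \<in> closure \<Omega>"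
  proof (rule continuous_le_on_closure[OF u_space_cont[OF t] that])
    show "u y t \<le> Linf_norm \<Omega> u t" if "y \<in> \<Omega>" for y using le[OF that] by simp
  qed
  obtain z where "z \<in> \<Omega>" using domain_nonempty by auto
  then show "0 \<le> Linf_norm \<Omega> u t" using le[of z] by linarith
  assume V: "\<And>x. x \<in> closure \<Omega> \<Longrightarrow> u x t \<le> V"
  show "Linf_norm \<Omega> u t \<le> V"
    unfolding Linf_norm_def
  proof (rule cSUP_least[OF domain_nonempty])
    fix x assume "x \<in> \<Omega>"
    then have "x \<in> closure \<Omega>" using closure_subset by auto
    then show "\<bar>u x t\<bar> \<le> V" using V u_nonneg[OF _ t] by simp
  qed
qed

text \<open>A norm below the rate at a single time would keep \<open>u\<close> bounded up to
  \<open>T\<close>, contradicting the blow-up.\<close>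

lemma blow_up_rate_lower:
  assumes blowup: "filterlim (\<lambda>t. Linf_norm \<Omega> u t) at_top (at_left T)" and t0: "t0 \<in> {0..<T}"
  shows "((p - 1) * (T - t0)) powr (- 1 / (p - 1)) \<le> Linf_norm \<Omega> u t0"
proof (rule ccontr)
  assume "\<not> ?thesis"
  then have "Linf_norm \<Omega> u t0 < ((p - 1) * (T - t0)) powr (- 1 / (p - 1))" by simp
  from bounded_below_rate[OF t0 Linf_norm_bounds(2)[OF t0] Linf_norm_bounds(1)[OF t0] this]
  obtain V where V: "\<And>x t. x \<in> closure \<Omega> \<Longrightarrow> t \<in> {t0..<T} \<Longrightarrow> u x t \<le> V" by blast
  have t0T: "t0 < T" using t0 by simp
  have "\<forall>\<^sub>F t in at_left T. V + 1 \<le> Linf_norm \<Omega> u t"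
    using blowup unfolding filterlim_at_top by blast
  moreover have "\<forall>\<^sub>F t in at_left T. t \<in> {t0..<T}"
    unfolding eventually_at_left[OF t0T] using t0T by auto
  ultimately have "\<forall>\<^sub>F t in at_left T. False"
  proof eventually_elim
    case (elim t)
    then have "Linf_norm \<Omega> u t \<le> V" using t0 by (intro Linf_norm_bounds(3) V) auto
    then show ?case using elim by simp
  qed
  then show False by simp
qed

end

theorem theorem5p5:
  fixes \<Omega> :: "'a::euclidean_space set" and J :: "'a \<Rightarrow> real" and \<eta> :: "'a \<Rightarrow> 'a"
    and d s0 p T :: real and u0 :: "'a \<Rightarrow> real" and u :: "'a \<Rightarrow> real \<Rightarrow> real"
  assumes "smooth_domain_normal \<Omega> \<eta>"
    and "kernel_J J d"
    and "s0 > d"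
    and "tubular_coords \<Omega> \<eta> s0"
    and "p > 1"
    and "continuous_on (closure \<Omega>) u0" and "\<forall>x\<in>closure \<Omega>. u0 x \<ge> 0"
    and "blows_up_at \<Omega> J \<eta> s0 p u0 T u"
  shows "\<exists>C. \<forall>t\<in>{0..<T}.
           (p - 1) powr (- 1 / (p - 1)) * (T - t) powr (- 1 / (p - 1)) \<le> Linf_norm \<Omega> u t \<and>
           Linf_norm \<Omega> u t \<le> C * (T - t) powr (- 1 / (p - 1))"
proof -
  interpret nonlocal_solution \<Omega> \<eta> s0 J d p T u0 u
    by unfold_locales (use assms in \<open>auto simp: blows_up_at_def\<close>)
  have blowup: "filterlim (\<lambda>t. Linf_norm \<Omega> u t) at_top (at_left T)"
    using assms(8) by (simp add: blows_up_at_def)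
  obtain C where C: "\<And>x t. x \<in> closure \<Omega> \<Longrightarrow> t \<in> {0..<T} \<Longrightarrow> u x t \<le> C * (T - t) powr (- 1 / (p - 1))"
    using blow_up_rate_upper by blast
  have "(p - 1) powr (- 1 / (p - 1)) * (T - t) powr (- 1 / (p - 1)) \<le> Linf_norm \<Omega> u t \<and>
      Linf_norm \<Omega> u t \<le> C * (T - t) powr (- 1 / (p - 1))" if t: "t \<in> {0..<T}" for t
    using blow_up_rate_lower[OF blowup t] Linf_norm_bounds(3)[OF t C[OF _ t]] p_gt t
    by (simp add: powr_mult)
  then show ?thesis by blast
qed

end
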